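(* Let $\mu$ be a singular Borel probability measure on $\mathbb{T}=(-1/2,1/2)$, and let $\{\alpha_n\}_{n=0}^{\infty}$ be the Taylor coefficients at $0$ of $\dfrac{1}{\mu_{+}(z)}$, where $\mu_{+}(z)=\int_{\mathbb{T}}\frac{1}{1-ze^{-2\pi i x}}\,d\mu(x)$ for $z\in\mathbb{D}$. Let $F:\mathbb{C}\to\mathbb{C}$ be an entire function. Then there exists $f\in L^2(\mu)$ such that $$F(z)=\int_{\mathbb{T}} f(x)e^{-2\pi i x z}\,d\mu(x)\qquad\text{for all } z\in\mathbb{C}$$ if and only if both of the following conditions hold: (i) $$\sum_{n=0}^{\infty}\left|\sum_{j=0}^{n}\alpha_{n-j}F(j)\right|^{2}<\infty;$$ (ii) for all $z\in\mathbb{C}$, $$F(z)=\sum_{n=0}^{\infty}\left(\sum_{j=0}^{n}\alpha_{n-j}F(j)\right)\left(\sum_{k=0}^{n}\overline{\alpha_{n-k}}\,\widehat{\mu}(z-k)\right).$$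
   Context: The circle $\mathbb{T}$ is identified with $(-1/2,1/2)$ via $x\mapsto e^{2\pi i x}$; it is a standing assumption that $\mu$ gives no mass to the point $1/2$ of the circle. "Singular" means singular with respect to Lebesgue measure. $\mathbb{D}$ is the open unit disc in $\mathbb{C}$. The Fourier-Stieltjes transform of $\mu$ is $\widehat{\mu}(z)=\int_{\mathbb{T}}e^{-2\pi i z x}\,d\mu(x)$, $z\in\mathbb{C}$. The Cauchy transform $\mu_{+}$ is analytic and nonvanishing on $\mathbb{D}$, so $1/\mu_{+}$ is analytic on $\mathbb{D}$. *)

theory Defs
  imports "HOL-Complex_Analysis.Complex_Analysis" "HOL-Probability.Probability"
begin

(* The circle with the point 1/2 removed, in the coordinate x \<mapsto> exp (2 \<pi> i x).
   Measures on it have this interval, not the whole real line, as their space. *)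
definition circle :: "real set" where
  "circle = {-1/2<..<1/2}"

(* Meaningful for measures on the same measurable space. *)
definition mutually_singular :: "'a measure \<Rightarrow> 'a measure \<Rightarrow> bool" where
  "mutually_singular M N \<longleftrightarrow>
     (\<exists>A\<in>sets M. emeasure N A = 0 \<and> emeasure M (space M - A) = 0)"

(* Representatives rather than classes modulo null sets. *)
definition square_integrable :: "'a measure \<Rightarrow> ('a \<Rightarrow> complex) \<Rightarrow> bool" where
  "square_integrable M f \<longleftrightarrow>
     f \<in> borel_measurable M \<and> integrable M (\<lambda>x. (norm (f x))\<^sup>2)"

definition fourier_stieltjes :: "real measure \<Rightarrow> complex \<Rightarrow> complex" where
  "fourier_stieltjes M z = (\<integral>x. exp (- 2 * of_real pi * \<i> * z * of_real x) \<partial>M)"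

(* Only its values on the open unit disc are used. *)
definition cauchy_transform :: "real measure \<Rightarrow> complex \<Rightarrow> complex" where
  "cauchy_transform M z =
     (\<integral>x. 1 / (1 - z * exp (- 2 * of_real pi * \<i> * of_real x)) \<partial>M)"

definition inv_cauchy_coeff :: "real measure \<Rightarrow> nat \<Rightarrow> complex" where
  "inv_cauchy_coeff M n = fps_nth (fps_expansion (\<lambda>z. 1 / cauchy_transform M z) 0) n"

end

theory Submission
  imports Defs
begin

text \<open>Write \<open>e\<^sub>w(x) = exp (2 \<pi> i w x)\<close> and \<open>g\<^sub>n = \<Sum>\<^sub>k\<^sub>\<le>\<^sub>n cnj (\<alpha>\<^sub>n\<^sub>-\<^sub>k) e\<^sub>k\<close>. Because \<open>\<alpha>\<close> is the
  convolution inverse of \<open>n \<mapsto> \<mu>^(n)\<close>, the partial sums of \<open>\<Sum> \<langle>f, g\<^sub>n\<rangle> e\<^sub>n\<close> are the Kaczmarz iterates of \<open>f\<close>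
  along \<open>e\<^sub>0, e\<^sub>1, \<dots>\<close>. Each step is an orthogonal projection, so \<open>\<Sum> |\<langle>f, g\<^sub>n\<rangle>|\<^sup>2 \<le> \<parallel>f\<parallel>\<^sup>2\<close>, with equality
  iff the residuals tend to \<open>0\<close>. For \<open>f = e\<^sub>-\<^sub>1\<close> equality means that \<open>1 - 1 / \<mu>\<^sub>+\<close> has \<open>H\<^sup>2\<close>-norm \<open>1\<close>;
  this holds because \<open>1 - |1 - 1 / \<mu>\<^sub>+|\<^sup>2\<close> is at most \<open>min (1, 4 P)\<close>, with \<open>P\<close> the Poisson integral of the
  singular measure \<open>\<mu>\<close>, which tends to \<open>0\<close> in Lebesgue measure at the boundary. Stationarity of
  \<open>(e\<^sub>n)\<close> transfers convergence from \<open>e\<^sub>-\<^sub>1\<close> to all \<open>e\<^sub>k\<close> with integral \<open>k\<close>, and approximation to all \<open>e\<^sub>w\<close>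
  with complex \<open>w\<close>. Since \<open>F(z)\<close> is the inner product of \<open>f\<close> with \<open>e\<^sub>w\<close> for \<open>w = cnj z\<close>, condition (ii)
  is the frame expansion of that inner product. Conversely the Bessel bound makes \<open>\<Sum> c\<^sub>n g\<^sub>n\<close>
  converge for square summable \<open>c\<close>.\<close>

section \<open>Square-integrable functions\<close>

definition inner_L2 :: "'a measure \<Rightarrow> ('a \<Rightarrow> complex) \<Rightarrow> ('a \<Rightarrow> complex) \<Rightarrow> complex" where
  "inner_L2 M f g = (\<integral>x. f x * cnj (g x) \<partial>M)"

text \<open>The square is kept because every step of the iteration is a Pythagorean identity; for
  limits, the quasi-triangle inequality \<open>sqnorm_L2_add_le\<close> with factor 2 is
  enough.\<close>

definition sqnorm_L2 :: "'a measure \<Rightarrow> ('a \<Rightarrow> complex) \<Rightarrow> real" where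
  "sqnorm_L2 M f = (\<integral>x. (norm (f x))\<^sup>2 \<partial>M)"

lemma norm_sq_add_le: "(norm (a + b))\<^sup>2 \<le> 2 * (norm a)\<^sup>2 + 2 * (norm b)\<^sup>2" for a b :: complex
proof -
  have "(norm (a + b))\<^sup>2 \<le> (norm a + norm b)\<^sup>2"
    by (intro power_mono norm_triangle_ineq) auto
  also have "\<dots> \<le> 2 * (norm a)\<^sup>2 + 2 * (norm b)\<^sup>2"
    using zero_le_power2[of "norm a - norm b"] by (simp add: power2_sum power2_diff)
  finally show ?thesis .
qed

lemma norm_mult_cnj_le: "norm (a * cnj b) \<le> ((norm a)\<^sup>2 + (norm b)\<^sup>2) / 2" for a b :: complex
  using zero_le_power2[of "norm a - norm b"] by (simp add: norm_mult power2_diff)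

lemma borel_measurable_cnj [measurable (raw)]:
  "f \<in> borel_measurable M \<Longrightarrow> (\<lambda>x. cnj (f x)) \<in> borel_measurable M"
  by (rule borel_measurable_continuous_on[OF continuous_on_cnj[OF continuous_on_id]])

lemma square_integrable_measurable [measurable_dest]:
  "square_integrable M f \<Longrightarrow> f \<in> borel_measurable M"
  by (simp add: square_integrable_def)

lemma square_integrableD: "square_integrable M f \<Longrightarrow> integrable M (\<lambda>x. (norm (f x))\<^sup>2)"
  by (simp add: square_integrable_def)

lemma square_integrable_add [intro]:
  assumes "square_integrable M f" "square_integrable M g"
  shows "square_integrable M (\<lambda>x. f x + g x)"
proof -
  note [measurable] = square_integrable_measurable[OF assms(1)] square_integrable_measurable[OF assms(2)]
  have "integrable M (\<lambda>x. (norm (f x + g x))\<^sup>2)"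
  proof (rule Bochner_Integration.integrable_bound)
    show "integrable M (\<lambda>x. 2 * (norm (f x))\<^sup>2 + 2 * (norm (g x))\<^sup>2)"
      using assms by (simp add: square_integrable_def)
    show "AE x in M. norm ((norm (f x + g x))\<^sup>2) \<le> norm (2 * (norm (f x))\<^sup>2 + 2 * (norm (g x))\<^sup>2)"
      using norm_sq_add_le by auto
  qed simp
  then show ?thesis
    unfolding square_integrable_def by simp
qed

lemma square_integrable_mult_bounded:
  assumes "square_integrable M f" and [measurable]: "b \<in> borel_measurable M"
    and B: "\<And>x. x \<in> space M \<Longrightarrow> norm (b x) \<le> B"
  shows "square_integrable M (\<lambda>x. b x * f x)"
proof -
  note [measurable] = square_integrable_measurable[OF assms(1)]
  have "integrable M (\<lambda>x. (norm (b x * f x))\<^sup>2)"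
  proof (rule Bochner_Integration.integrable_bound)
    show "integrable M (\<lambda>x. B\<^sup>2 * (norm (f x))\<^sup>2)"
      using assms by (simp add: square_integrable_def)
    have "(norm (b x))\<^sup>2 \<le> B\<^sup>2" if "x \<in> space M" for x
      using B[OF that] by (intro power_mono) auto
    then show "AE x in M. norm ((norm (b x * f x))\<^sup>2) \<le> norm (B\<^sup>2 * (norm (f x))\<^sup>2)"
      by (auto simp: norm_mult power_mult_distrib intro!: mult_right_mono)
  qed simp
  then show ?thesis
    unfolding square_integrable_def by simp
qed

lemma square_integrable_cmult [intro]:
  "square_integrable M f \<Longrightarrow> square_integrable M (\<lambda>x. c * f x)"
  by (rule square_integrable_mult_bounded[where B = "norm c"]) auto

lemma square_integrable_diff [intro]:
  "square_integrable M f \<Longrightarrow> square_integrable M g \<Longrightarrow> square_integrable M (\<lambda>x. f x - g x)"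
  using square_integrable_add[of M f "\<lambda>x. (-1) * g x"] square_integrable_cmult[of M g "-1"] by simp

lemma square_integrable_sum [intro]:
  "(\<And>i. i \<in> I \<Longrightarrow> square_integrable M (f i)) \<Longrightarrow> square_integrable M (\<lambda>x. \<Sum>i\<in>I. f i x)"
proof (induction I rule: infinite_finite_induct)
  case (insert i I)
  then show ?case by (simp add: square_integrable_add)
qed (auto simp: square_integrable_def)

lemma (in finite_measure) square_integrable_bounded:
  assumes [measurable]: "f \<in> borel_measurable M" and "\<And>x. x \<in> space M \<Longrightarrow> norm (f x) \<le> B"
  shows "square_integrable M f"
  using square_integrable_mult_bounded[of M "\<lambda>_. 1" f B] assms by (simp add: square_integrable_def)

lemma integrable_mult_cnj:
  assumes "square_integrable M f" "square_integrable M g"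
  shows "integrable M (\<lambda>x. f x * cnj (g x))"
proof (rule Bochner_Integration.integrable_bound)
  note [measurable] = square_integrable_measurable[OF assms(1)] square_integrable_measurable[OF assms(2)]
  show "integrable M (\<lambda>x. ((norm (f x))\<^sup>2 + (norm (g x))\<^sup>2) / 2)"
    using assms by (simp add: square_integrable_def)
  show "(\<lambda>x. f x * cnj (g x)) \<in> borel_measurable M" by measurable
  show "AE x in M. norm (f x * cnj (g x)) \<le> norm (((norm (f x))\<^sup>2 + (norm (g x))\<^sup>2) / 2)"
    using norm_mult_cnj_le by auto
qed

section \<open>Algebra of the inner product, Cauchy-Schwarz and completeness\<close>

lemma inner_L2_diff_left:
  "square_integrable M f \<Longrightarrow> square_integrable M g \<Longrightarrow> square_integrable M h \<Longrightarrow>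
    inner_L2 M (\<lambda>x. f x - g x) h = inner_L2 M f h - inner_L2 M g h"
  using Bochner_Integration.integral_diff[OF integrable_mult_cnj[of M f h] integrable_mult_cnj[of M g h]]
  by (simp add: inner_L2_def algebra_simps)

lemma inner_L2_cmult_left: "inner_L2 M (\<lambda>x. c * f x) h = c * inner_L2 M f h"
  by (simp add: inner_L2_def mult.assoc)

lemma inner_L2_sum_left:
  "(\<And>i. i \<in> I \<Longrightarrow> square_integrable M (f i)) \<Longrightarrow> square_integrable M h \<Longrightarrow>
    inner_L2 M (\<lambda>x. \<Sum>i\<in>I. f i x) h = (\<Sum>i\<in>I. inner_L2 M (f i) h)"
  unfolding inner_L2_def sum_distrib_right
  by (rule Bochner_Integration.integral_sum) (rule integrable_mult_cnj)

lemma inner_L2_cnj: "cnj (inner_L2 M f g) = inner_L2 M g f"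
  unfolding inner_L2_def by (subst Bochner_Integration.integral_cnj [symmetric]) (simp add: mult.commute)

lemma inner_L2_diff_right:
  assumes "square_integrable M f" "square_integrable M g" "square_integrable M h"
  shows "inner_L2 M h (\<lambda>x. f x - g x) = inner_L2 M h f - inner_L2 M h g"
  using inner_L2_diff_left[OF assms] by (metis inner_L2_cnj complex_cnj_diff)

lemma inner_L2_cmult_right: "inner_L2 M h (\<lambda>x. c * f x) = cnj c * inner_L2 M h f"
  using inner_L2_cmult_left[of M c f h] by (metis inner_L2_cnj complex_cnj_mult)

lemma inner_L2_sum_right:
  assumes "\<And>i. i \<in> I \<Longrightarrow> square_integrable M (f i)" "square_integrable M h"
  shows "inner_L2 M h (\<lambda>x. \<Sum>i\<in>I. f i x) = (\<Sum>i\<in>I. inner_L2 M h (f i))"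
  unfolding inner_L2_cnj[of M _ h, symmetric] by (simp add: inner_L2_sum_left[OF assms])

lemma inner_L2_self: "inner_L2 M f f = of_real (sqnorm_L2 M f)"
  unfolding inner_L2_def sqnorm_L2_def complex_norm_square[symmetric]
  by (rule integral_complex_of_real)

lemma sqnorm_L2_nonneg [simp]: "sqnorm_L2 M f \<ge> 0"
  by (simp add: sqnorm_L2_def)

lemma sqnorm_L2_cmult: "sqnorm_L2 M (\<lambda>x. c * f x) = (norm c)\<^sup>2 * sqnorm_L2 M f"
  by (simp add: sqnorm_L2_def norm_mult power_mult_distrib)

lemma sqnorm_L2_add_le:
  assumes "square_integrable M f" "square_integrable M g"
  shows "sqnorm_L2 M (\<lambda>x. f x + g x) \<le> 2 * sqnorm_L2 M f + 2 * sqnorm_L2 M g"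
proof -
  have "sqnorm_L2 M (\<lambda>x. f x + g x) \<le> (\<integral>x. 2 * (norm (f x))\<^sup>2 + 2 * (norm (g x))\<^sup>2 \<partial>M)"
    unfolding sqnorm_L2_def
  proof (rule integral_mono)
    show "integrable M (\<lambda>x. (norm (f x + g x))\<^sup>2)"
      using square_integrable_add[OF assms] by (simp add: square_integrable_def)
    show "integrable M (\<lambda>x. 2 * (norm (f x))\<^sup>2 + 2 * (norm (g x))\<^sup>2)"
      using assms by (simp add: square_integrable_def)
  qed (rule norm_sq_add_le)
  also have "\<dots> = 2 * sqnorm_L2 M f + 2 * sqnorm_L2 M g"
    using assms by (simp add: square_integrable_def sqnorm_L2_def)
  finally show ?thesis .
qed

lemma Cauchy_Schwarz_L2:
  assumes f: "square_integrable M f" and g: "square_integrable M g"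
  shows "(norm (inner_L2 M f g))\<^sup>2 \<le> sqnorm_L2 M f * sqnorm_L2 M g"
proof -
  note [measurable] = square_integrable_measurable[OF f] square_integrable_measurable[OF g]
  have nn: "(\<integral>\<^sup>+x. (ennreal (norm (h x)))\<^sup>2 \<partial>M) = ennreal (sqnorm_L2 M h)" if "square_integrable M h" for h
    using square_integrableD[OF that]
    by (simp add: sqnorm_L2_def nn_integral_eq_integral ennreal_power)
  have "ennreal (norm (inner_L2 M f g)) \<le> (\<integral>\<^sup>+x. norm (f x * cnj (g x)) \<partial>M)"
    unfolding inner_L2_def by (rule integral_norm_bound_ennreal) (rule integrable_mult_cnj[OF f g])
  also have "\<dots> = (\<integral>\<^sup>+x. ennreal (norm (f x)) * ennreal (norm (g x)) \<partial>M)"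
    by (simp add: norm_mult ennreal_mult)
  finally have "(ennreal (norm (inner_L2 M f g)))\<^sup>2 \<le> (\<integral>\<^sup>+x. ennreal (norm (f x)) * ennreal (norm (g x)) \<partial>M)\<^sup>2"
    by (intro power_mono) auto
  also have "\<dots> \<le> (\<integral>\<^sup>+x. (ennreal (norm (f x)))\<^sup>2 \<partial>M) * (\<integral>\<^sup>+x. (ennreal (norm (g x)))\<^sup>2 \<partial>M)"
    by (rule Cauchy_Schwarz_nn_integral) measurable
  also have "\<dots> = ennreal (sqnorm_L2 M f * sqnorm_L2 M g)"
    by (simp add: nn f g ennreal_mult)
  finally show ?thesis
    by (simp add: ennreal_power)
qed

text \<open>Riesz-Fischer. On a probability space an L2-Cauchy sequence is L1-Cauchy, so a
  subsequence converges almost everywhere; Fatou along that subsequence bounds the L2 distance of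
  \<open>s n\<close> from the pointwise limit.\<close>

lemma (in prob_space) L2_complete:
  assumes s: "\<And>n. square_integrable M (s n)"
    and Cauchy: "\<And>e. e > 0 \<Longrightarrow> \<exists>N. \<forall>m\<ge>N. \<forall>n\<ge>N. sqnorm_L2 M (\<lambda>x. s m x - s n x) \<le> e"
  obtains f where "square_integrable M f" "(\<lambda>n. sqnorm_L2 M (\<lambda>x. s n x - f x)) \<longlonglongrightarrow> 0"
proof -
  note [measurable] = square_integrable_measurable[OF s]
  have one: "square_integrable M (\<lambda>_. 1)" by (simp add: square_integrable_def)
  \<comment> \<open>Cauchy-Schwarz against the constant 1, which has norm 1 because the total mass
    is 1.\<close>
  have L1: "(LINT x|M. norm (h x))\<^sup>2 \<le> sqnorm_L2 M h" if h: "square_integrable M h" for h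
  proof -
    have "square_integrable M (\<lambda>x. of_real (norm (h x)))"
      using h unfolding square_integrable_def by auto
    from Cauchy_Schwarz_L2[OF this one] show ?thesis
      by (simp add: inner_L2_def sqnorm_L2_def prob_space)
  qed
  obtain r where r: "strict_mono r" "AE x in M. Cauchy (\<lambda>i. s (r i) x)"
  proof (rule cauchy_L1_AE_cauchy_subseq)
    show "integrable M (s n)" for n
      using integrable_mult_cnj[OF s one] by simp
    fix e :: real assume e: "e > 0"
    then obtain N where N: "\<forall>m\<ge>N. \<forall>n\<ge>N. sqnorm_L2 M (\<lambda>x. s m x - s n x) \<le> (e/2)\<^sup>2"
      using Cauchy[of "(e/2)\<^sup>2"] by auto
    have "LINT x|M. norm (s i x - s j x) < e" if "i \<ge> N" "j \<ge> N" for i j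
    proof -
      have "(LINT x|M. norm (s i x - s j x))\<^sup>2 \<le> (e/2)\<^sup>2"
        using L1[OF square_integrable_diff[OF s s], of i j] N that by force
      then have "(LINT x|M. norm (s i x - s j x)) \<le> e/2"
        by (rule power2_le_imp_le) (use e in auto)
      with e show ?thesis by linarith
    qed
    then show "\<exists>N. \<forall>i\<ge>N. \<forall>j\<ge>N. LINT x|M. norm (s i x - s j x) < e" by blast
  qed
  define f where "f = (\<lambda>x. lim (\<lambda>i. s (r i) x))"
  have [measurable]: "f \<in> borel_measurable M"
    unfolding f_def by measurable
  have lim: "AE x in M. (\<lambda>i. s (r i) x) \<longlonglongrightarrow> f x"
    using r(2) by eventually_elim (simp add: f_def Cauchy_convergent_iff convergent_LIMSEQ_iff)
  have fatou: "(\<integral>\<^sup>+x. (norm (s n x - f x))\<^sup>2 \<partial>M) \<le> ennreal e"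
    if n: "\<forall>m\<ge>N. \<forall>n\<ge>N. sqnorm_L2 M (\<lambda>x. s m x - s n x) \<le> e" "n \<ge> N" for n N e
  proof -
    have "(\<integral>\<^sup>+x. (norm (s n x - f x))\<^sup>2 \<partial>M) = (\<integral>\<^sup>+x. liminf (\<lambda>i. ennreal ((norm (s n x - s (r i) x))\<^sup>2)) \<partial>M)"
    proof (rule nn_integral_cong_AE, use lim in eventually_elim)
      case (elim x)
      then have "(\<lambda>i. ennreal ((norm (s n x - s (r i) x))\<^sup>2)) \<longlonglongrightarrow> ennreal ((norm (s n x - f x))\<^sup>2)"
        by (intro tendsto_ennrealI tendsto_intros)
      then show ?case
        using lim_imp_Liminf[OF sequentially_bot] by metis
    qed
    also have "\<dots> \<le> liminf (\<lambda>i. \<integral>\<^sup>+x. (norm (s n x - s (r i) x))\<^sup>2 \<partial>M)"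
      by (rule nn_integral_liminf) measurable
    also have "\<dots> \<le> liminf (\<lambda>i. ennreal e)"
    proof (rule Liminf_mono)
      have "eventually (\<lambda>i. r i \<ge> N) sequentially"
        using r(1) by (meson eventually_sequentiallyI le_trans seq_suble)
      then show "\<forall>\<^sub>F i in sequentially. (\<integral>\<^sup>+x. (norm (s n x - s (r i) x))\<^sup>2 \<partial>M) \<le> ennreal e"
      proof eventually_elim
        case (elim i)
        then have "sqnorm_L2 M (\<lambda>x. s n x - s (r i) x) \<le> e" using n by blast
        then show ?case
          using square_integrableD[OF square_integrable_diff[OF s s], of n "r i"]
          by (simp add: sqnorm_L2_def nn_integral_eq_integral ennreal_leI)
      qed
    qed
    also have "\<dots> = ennreal e" by (simp add: Liminf_const)
    finally show ?thesis .
  qed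
  have diff: "square_integrable M (\<lambda>x. s n x - f x) \<and> sqnorm_L2 M (\<lambda>x. s n x - f x) \<le> e"
    if n: "\<forall>m\<ge>N. \<forall>n\<ge>N. sqnorm_L2 M (\<lambda>x. s m x - s n x) \<le> e" "n \<ge> N" for n N e
  proof -
    \<comment> \<open>\<open>ennreal\<close> sends negative reals to 0, so the Fatou bound can be
      read back in the reals only for nonnegative \<open>e\<close>.\<close>
    have e: "e \<ge> 0" using n(1) by (meson order_trans sqnorm_L2_nonneg order_refl)
    have int: "integrable M (\<lambda>x. (norm (s n x - f x))\<^sup>2)"
      using fatou[OF n] by (intro integrableI_bounded) (auto simp: le_less_trans)
    moreover have "ennreal (sqnorm_L2 M (\<lambda>x. s n x - f x)) \<le> ennreal e"
      using fatou[OF n] int by (simp add: sqnorm_L2_def nn_integral_eq_integral)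
    ultimately show ?thesis using e by (simp add: square_integrable_def)
  qed
  have "(\<lambda>n. sqnorm_L2 M (\<lambda>x. s n x - f x)) \<longlonglongrightarrow> 0"
  proof (rule LIMSEQ_I)
    fix e :: real assume e: "e > 0"
    obtain N where N: "\<forall>m\<ge>N. \<forall>n\<ge>N. sqnorm_L2 M (\<lambda>x. s m x - s n x) \<le> e/2"
      using Cauchy[of "e/2"] e by auto
    have "norm (sqnorm_L2 M (\<lambda>x. s n x - f x) - 0) < e" if "n \<ge> N" for n
      using diff[OF N that] e by auto
    then show "\<exists>N. \<forall>n\<ge>N. norm (sqnorm_L2 M (\<lambda>x. s n x - f x) - 0) < e" by blast
  qed
  moreover have "square_integrable M f"
  proof -
    obtain N where N: "\<forall>m\<ge>N. \<forall>n\<ge>N. sqnorm_L2 M (\<lambda>x. s m x - s n x) \<le> 1"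
      using Cauchy[of 1] by auto
    \<comment> \<open>Here \<open>f\<close> is recovered as \<open>s N - (s N - f)\<close>.\<close>
    from square_integrable_diff[OF s[of N] conjunct1[OF diff[OF N order_refl]]]
    show ?thesis by simp
  qed
  ultimately show thesis using that by blast
qed

section \<open>Exponentials and the Cauchy transform\<close>

definition fexp :: "complex \<Rightarrow> real \<Rightarrow> complex" where
  "fexp w x = exp (2 * of_real pi * \<i> * w * of_real x)"

lemma fexp_add: "fexp (a + b) x = fexp a x * fexp b x"
  by (simp add: fexp_def exp_add [symmetric] algebra_simps)

lemma fexp_0 [simp]: "fexp 0 x = 1"
  by (simp add: fexp_def)

lemma cnj_fexp: "cnj (fexp w x) = fexp (- cnj w) x"
  by (simp add: fexp_def exp_cnj)

lemma fexp_mult_nat: "fexp (of_nat n * w) x = fexp w x ^ n"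
  by (simp add: fexp_def exp_of_nat_mult [symmetric] algebra_simps)

lemma fexp_diff_arg: "fexp w (x - y) = fexp w x * fexp (- w) y"
  by (simp add: fexp_def exp_add [symmetric] algebra_simps)

lemma norm_fexp: "norm (fexp w x) = exp (- 2 * pi * Im w * x)"
  by (simp add: fexp_def)

lemma norm_fexp_real [simp]:
  "norm (fexp 1 x) = 1" "norm (fexp (- 1) x) = 1"
  "norm (fexp (of_nat n) x) = 1" "norm (fexp (- of_nat n) x) = 1"
  "norm (fexp (of_int k) x) = 1" "norm (fexp (- of_int k) x) = 1"
  by (simp_all add: norm_fexp)

lemma continuous_on_fexp [continuous_intros]:
  "continuous_on A g \<Longrightarrow> continuous_on A (\<lambda>x. fexp w (g x))"
  unfolding fexp_def by (intro continuous_intros)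

lemma borel_measurable_fexp [measurable]: "fexp w \<in> borel_measurable borel"
  by (intro borel_measurable_continuous_onI continuous_intros)

text \<open>The interval is bounded, so even exponentials with non-real frequency are bounded on it
  and hence square integrable.\<close>

lemma norm_fexp_le_circle:
  assumes "x \<in> circle"
  shows "norm (fexp w x) \<le> exp (pi * norm w)"
proof -
  have "\<bar>x\<bar> \<le> 1/2" using assms by (auto simp: circle_def)
  then have "\<bar>Im w\<bar> * \<bar>x\<bar> \<le> norm w * (1/2)"
    by (intro mult_mono abs_Im_le_cmod) auto
  then have "pi * (- 2 * Im w * x) \<le> pi * norm w"
    by (intro mult_left_mono) (auto simp: abs_mult [symmetric])
  then show ?thesis
    by (simp add: norm_fexp mult.assoc mult.left_commute)
qed

text \<open>The real part of the Herglotz kernel \<open>(1 + w) / (1 - w)\<close>, that is, the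
  Poisson kernel of the disc with pole at 1.\<close>

definition disc_poisson :: "complex \<Rightarrow> real" where
  "disc_poisson w = (1 - (norm w)\<^sup>2) / (norm (1 - w))\<^sup>2"

lemma disc_poisson_nonneg: "norm w < 1 \<Longrightarrow> disc_poisson w \<ge> 0"
  by (simp add: disc_poisson_def abs_square_le_1)

text \<open>\<open>1 / (1 - w)\<close> is the mean of 1 and the Herglotz kernel. This is how Cauchy
  integrals turn into Poisson integrals.\<close>

lemma Re_inverse_one_minus:
  assumes "norm w < 1"
  shows "Re (1 / (1 - w)) = (1 + disc_poisson w) / 2"
proof -
  define d where "d = (norm (1 - w))\<^sup>2"
  have "d \<noteq> 0" using assms by (auto simp: d_def)
  moreover have "2 * (1 - Re w) = d + (1 - (norm w)\<^sup>2)"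
    unfolding d_def cmod_power2 by (simp add: power2_eq_square algebra_simps)
  moreover have "Re (1 / (1 - w)) = (1 - Re w) / d"
    by (simp add: d_def Re_divide cmod_power2)
  ultimately show ?thesis
    by (simp add: disc_poisson_def d_def [symmetric] field_simps)
qed

section \<open>Probability measures on the circle and their Cauchy transforms\<close>

locale circle_measure = prob_space M for M :: "real measure" +
  assumes sets_M: "sets M = sets (restrict_space borel circle)"
begin

lemma space_M: "space M = circle"
  using sets_eq_imp_space_eq[OF sets_M] by (simp add: space_restrict_space)

lemma measurable_borel_imp_M:
  assumes "f \<in> borel \<rightarrow>\<^sub>M N"
  shows "f \<in> M \<rightarrow>\<^sub>M N"
  using measurable_restrict_space1[OF assms, of circle] measurable_cong_sets[OF sets_M refl] by blast

lemma measurable_ident_M [measurable]: "(\<lambda>x. x) \<in> M \<rightarrow>\<^sub>M borel"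
  by (rule measurable_borel_imp_M) simp

lemma square_integrable_fexp [intro, simp]: "square_integrable M (fexp w)"
  by (rule square_integrable_bounded[where B = "exp (pi * norm w)"])
     (auto simp: space_M intro: norm_fexp_le_circle measurable_borel_imp_M)

lemma fourier_stieltjes_conv_fexp: "fourier_stieltjes M z = (\<integral>x. fexp (- z) x \<partial>M)"
  by (simp add: fourier_stieltjes_def fexp_def)

lemma inner_fexp: "inner_L2 M (fexp a) (fexp b) = fourier_stieltjes M (cnj b - a)"
  by (simp add: inner_L2_def fourier_stieltjes_conv_fexp cnj_fexp fexp_add [symmetric])

lemma fourier_stieltjes_0 [simp]: "fourier_stieltjes M 0 = 1"
  by (simp add: fourier_stieltjes_conv_fexp prob_space)

lemma cauchy_transform_conv_fexp: "cauchy_transform M z = (\<integral>x. 1 / (1 - z * fexp (- 1) x) \<partial>M)"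
  by (simp add: cauchy_transform_def fexp_def)

lemma integrable_bounded_circle:
  fixes f :: "real \<Rightarrow> 'b::{banach, second_countable_topology}"
  assumes "f \<in> borel_measurable M" "\<And>x. x \<in> circle \<Longrightarrow> norm (f x) \<le> B"
  shows "integrable M f"
  using assms by (intro integrable_const_bound[where B = B]) (auto simp: space_M intro!: AE_I2)

text \<open>The Cauchy kernel is expanded in a geometric series and integrated termwise; since the
  exponentials are unimodular, the terms are dominated by \<open>norm z ^ n\<close>.\<close>

lemma cauchy_transform_sums:
  assumes z: "norm z < 1"
  shows "(\<lambda>n. fourier_stieltjes M (of_nat n) * z ^ n) sums cauchy_transform M z"
proof -
  have "(\<lambda>n. \<integral>x. z ^ n * fexp (- of_nat n) x \<partial>M) sums (\<integral>x. (\<Sum>n. z ^ n * fexp (- of_nat n) x) \<partial>M)"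
  proof (rule sums_integral)
    show "integrable M (\<lambda>x. z ^ n * fexp (- of_nat n) x)" for n
      by (rule integrable_bounded_circle[where B = "norm z ^ n"])
         (auto simp: norm_mult norm_power intro: measurable_borel_imp_M)
    show "AE x in M. summable (\<lambda>n. norm (z ^ n * fexp (- of_nat n) x))"
      using z by (simp add: norm_mult norm_power)
    show "summable (\<lambda>n. \<integral>x. norm (z ^ n * fexp (- of_nat n) x) \<partial>M)"
      using z by (simp add: norm_mult norm_power prob_space)
  qed
  also have "(\<lambda>x. \<Sum>n. z ^ n * fexp (- of_nat n) x) = (\<lambda>x. 1 / (1 - z * fexp (- 1) x))"
  proof
    fix x
    have "(\<lambda>n. (z * fexp (- 1) x) ^ n) sums (1 / (1 - z * fexp (- 1) x))"
      by (rule geometric_sums) (use z in \<open>simp add: norm_mult\<close>)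
    moreover have "(z * fexp (- 1) x) ^ n = z ^ n * fexp (- of_nat n) x" for n
      using fexp_mult_nat[of n "-1" x] by (simp add: power_mult_distrib)
    ultimately show "(\<Sum>n. z ^ n * fexp (- of_nat n) x) = 1 / (1 - z * fexp (- 1) x)"
      by (simp add: sums_iff)
  qed
  finally show ?thesis
    by (simp add: cauchy_transform_conv_fexp fourier_stieltjes_conv_fexp mult.commute)
qed

lemma cauchy_transform_has_fps_expansion:
  "cauchy_transform M has_fps_expansion Abs_fps (\<lambda>n. fourier_stieltjes M (of_nat n))" (is "_ has_fps_expansion ?F")
  and cauchy_transform_holomorphic: "cauchy_transform M holomorphic_on ball 0 1"
proof -
  have "conv_radius (\<lambda>n. fourier_stieltjes M (of_nat n)) \<ge> 1"
  proof (rule conv_radius_geI_ex)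
    fix r :: real assume "0 < r" "ereal r < 1"
    then show "\<exists>z. norm z = r \<and> summable (\<lambda>n. fourier_stieltjes M (of_nat n) * z ^ n)"
      using cauchy_transform_sums[of "of_real r"]
      by (intro exI[of _ "of_real r"]) (auto simp: sums_iff)
  qed
  then have rad: "fps_conv_radius ?F \<ge> 1" by (simp add: fps_conv_radius_def)
  have eval: "eval_fps ?F z = cauchy_transform M z" if "norm z < 1" for z
    using cauchy_transform_sums[OF that] by (simp add: eval_fps_def sums_iff)
  have "eventually (\<lambda>z. z \<in> ball 0 (1::real)) (nhds (0::complex))"
    by (intro eventually_nhds_in_open) auto
  then have "eventually (\<lambda>z. eval_fps ?F z = cauchy_transform M z) (nhds 0)"
    by eventually_elim (simp add: eval)
  then show "cauchy_transform M has_fps_expansion ?F"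
    using rad by (auto simp: has_fps_expansion_def intro: less_le_trans[of 0 1])
  have "eval_fps ?F holomorphic_on ball 0 1"
  proof (rule holomorphic_on_eval_fps)
    show "ball 0 1 \<subseteq> eball 0 (fps_conv_radius ?F)"
      using order.strict_trans2[OF _ rad] by (auto simp: in_eball_iff)
  qed
  then show "cauchy_transform M holomorphic_on ball 0 1"
    by (rule holomorphic_transform) (simp add: eval)
qed

lemma measurable_fexp_M [measurable]: "fexp w \<in> borel_measurable M"
  by (rule measurable_borel_imp_M) simp

lemma Re_cauchy_transform:
  assumes z: "norm z < 1"
  shows "Re (cauchy_transform M z) = (1 + (\<integral>x. disc_poisson (z * fexp (- 1) x) \<partial>M)) / 2"
    and "integrable M (\<lambda>x. disc_poisson (z * fexp (- 1) x))"
proof -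
  have nz: "norm (z * fexp (- 1) x) < 1" for x using z by (simp add: norm_mult)
  have [simp]: "z * fexp (- 1) x \<noteq> 1" for x using nz[of x] by auto
  have "1 - norm z \<le> norm (1 - z * fexp (- 1) x)" for x
    using norm_triangle_ineq2[of 1 "z * fexp (- 1) x"] by (simp add: norm_mult)
  then have int: "integrable M (\<lambda>x. 1 / (1 - z * fexp (- 1) x))"
    using z by (intro integrable_bounded_circle[where B = "1 / (1 - norm z)"])
       (auto simp: norm_divide intro!: divide_left_mono mult_pos_pos)
  have eq: "disc_poisson (z * fexp (- 1) x) = 2 * Re (1 / (1 - z * fexp (- 1) x)) - 1" for x
    unfolding Re_inverse_one_minus[OF nz] by (simp add: field_simps)
  show "integrable M (\<lambda>x. disc_poisson (z * fexp (- 1) x))"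
    unfolding eq using int by (intro Bochner_Integration.integrable_diff integrable_mult_right integrable_Re) auto
  show "Re (cauchy_transform M z) = (1 + (\<integral>x. disc_poisson (z * fexp (- 1) x) \<partial>M)) / 2"
    unfolding eq cauchy_transform_conv_fexp using integrable_Re[OF int] integral_Re[OF int] 
    by (simp add: prob_space)
qed

text \<open>Positivity of the Poisson kernel. The bound makes the transform zero-free, and it later
  yields the factor 4 in \<open>inverse_cauchy_transform_le\<close>.\<close>

lemma Re_cauchy_transform_ge:
  assumes "norm z < 1"
  shows "Re (cauchy_transform M z) \<ge> 1/2"
  using assms unfolding Re_cauchy_transform(1)[OF assms]
  by (auto intro!: Bochner_Integration.integral_nonneg disc_poisson_nonneg simp: norm_mult)

section \<open>The reciprocal of the Cauchy transform and its Taylor coefficients\<close>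

lemma cauchy_transform_nonzero: "norm z < 1 \<Longrightarrow> cauchy_transform M z \<noteq> 0"
  using Re_cauchy_transform_ge[of z] by auto

lemma inverse_cauchy_transform_holomorphic: "(\<lambda>z. 1 / cauchy_transform M z) holomorphic_on ball 0 1"
  by (intro holomorphic_intros cauchy_transform_holomorphic) (simp add: cauchy_transform_nonzero)

lemma inverse_cauchy_transform_fps:
  "(\<lambda>z. 1 / cauchy_transform M z) has_fps_expansion Abs_fps (inv_cauchy_coeff M)"
proof -
  have "(\<lambda>z. 1 / cauchy_transform M z) has_fps_expansion fps_expansion (\<lambda>z. 1 / cauchy_transform M z) 0"
    by (rule has_fps_expansion_fps_expansion[OF _ _ inverse_cauchy_transform_holomorphic]) auto
  then show ?thesis by (simp add: inv_cauchy_coeff_def [abs_def] fps_nth_inverse)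
qed

lemma inv_cauchy_coeff_sums:
  "norm z < 1 \<Longrightarrow> (\<lambda>n. inv_cauchy_coeff M n * z ^ n) sums (1 / cauchy_transform M z)"
  using has_fps_expansion_imp_sums_complex[OF inverse_cauchy_transform_fps, of 1 z]
    inverse_cauchy_transform_holomorphic by (simp add: one_ereal_def)

lemma inv_cauchy_coeff_fps:
  "Abs_fps (inv_cauchy_coeff M) * Abs_fps (\<lambda>n. fourier_stieltjes M (of_nat n)) = 1"
proof -
  have "(\<lambda>z. inverse (cauchy_transform M z)) has_fps_expansion
      inverse (Abs_fps (\<lambda>n. fourier_stieltjes M (of_nat n)))"
    by (intro has_fps_expansion_inverse cauchy_transform_has_fps_expansion) simp
  then have "Abs_fps (inv_cauchy_coeff M) = inverse (Abs_fps (\<lambda>n. fourier_stieltjes M (of_nat n)))"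
    using fps_expansion_unique_complex[OF inverse_cauchy_transform_fps] by (simp add: inverse_eq_divide)
  then show ?thesis by (simp add: inverse_mult_eq_1)
qed

text \<open>Coefficientwise form of the product of \<open>\<mu>\<^sub>+\<close> and its reciprocal
  being 1: the sequence \<alpha> inverts the Toeplitz system of the moments.\<close>

lemma inv_cauchy_coeff_convolution:
  "(\<Sum>j\<le>n. inv_cauchy_coeff M (n - j) * fourier_stieltjes M (of_nat j)) = (if n = 0 then 1 else 0)"
proof -
  have "fps_nth (Abs_fps (\<lambda>n. fourier_stieltjes M (of_nat n)) * Abs_fps (inv_cauchy_coeff M)) n = (if n = 0 then 1 else 0)"
    by (subst mult.commute) (simp add: inv_cauchy_coeff_fps)
  then show ?thesis
    by (simp only: fps_mult_nth atLeast0AtMost fps_nth_Abs_fps) (simp only: mult.commute)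
qed

end

section \<open>The Kaczmarz iteration\<close>

context circle_measure
begin

text \<open>The auxiliary sequence of the Kaczmarz algorithm. It is commonly given by the recursion
  \<open>g\<^sub>n = e\<^sub>n - (\<Sum>k<n. \<langle>e\<^sub>n, e\<^sub>k\<rangle>
  g\<^sub>k)\<close>; for stationary \<open>e\<^sub>n\<close> the recursion is a convolution
  equation, solved here in closed form.\<close>

definition dual_vector :: "nat \<Rightarrow> real \<Rightarrow> complex" where
  "dual_vector n x = (\<Sum>k\<le>n. cnj (inv_cauchy_coeff M (n - k)) * fexp (of_nat k) x)"

definition kaczmarz_coeff :: "(real \<Rightarrow> complex) \<Rightarrow> nat \<Rightarrow> complex" where
  "kaczmarz_coeff f n = inner_L2 M f (dual_vector n)"

definition residual :: "(real \<Rightarrow> complex) \<Rightarrow> nat \<Rightarrow> real \<Rightarrow> complex" where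
  "residual f n x = f x - (\<Sum>k<n. kaczmarz_coeff f k * fexp (of_nat k) x)"

definition kaczmarz_converges :: "(real \<Rightarrow> complex) \<Rightarrow> bool" where
  "kaczmarz_converges f \<longleftrightarrow> (\<lambda>n. sqnorm_L2 M (residual f n)) \<longlonglongrightarrow> 0"

lemma square_integrable_dual_vector [intro, simp]: "square_integrable M (dual_vector n)"
  unfolding dual_vector_def by (intro square_integrable_sum square_integrable_cmult square_integrable_fexp)

lemma square_integrable_residual [intro, simp]:
  "square_integrable M f \<Longrightarrow> square_integrable M (residual f n)"
  unfolding residual_def
  by (intro square_integrable_diff square_integrable_sum square_integrable_cmult square_integrable_fexp)

lemma kaczmarz_coeff_eq:
  assumes "square_integrable M f"
  shows "kaczmarz_coeff f n = (\<Sum>j\<le>n. inv_cauchy_coeff M (n - j) * inner_L2 M f (fexp (of_nat j)))"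
  unfolding kaczmarz_coeff_def dual_vector_def
  by (subst inner_L2_sum_right) (auto intro: assms simp: inner_L2_cmult_right)

lemma inner_fexp_nat: "k \<le> n \<Longrightarrow> inner_L2 M (fexp (of_nat k)) (fexp (of_nat n)) = fourier_stieltjes M (of_nat (n - k))"
  by (simp add: inner_fexp of_nat_diff)

text \<open>Inverts \<open>kaczmarz_coeff_eq\<close>: as formal power series, the coefficients are
  the inner products times \<alpha>, so multiplying by the moment series recovers the inner
  products.\<close>

lemma inner_fexp_kaczmarz:
  assumes "square_integrable M f"
  shows "inner_L2 M f (fexp (of_nat n)) = (\<Sum>k\<le>n. kaczmarz_coeff f k * fourier_stieltjes M (of_nat (n - k)))"
proof -
  let ?\<phi> = "Abs_fps (\<lambda>j. inner_L2 M f (fexp (of_nat j)))"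
  let ?\<alpha> = "Abs_fps (inv_cauchy_coeff M)"
  let ?m = "Abs_fps (\<lambda>n. fourier_stieltjes M (of_nat n))"
  have "fps_nth (?\<phi> * ?\<alpha>) n = fps_nth (Abs_fps (kaczmarz_coeff f)) n" for n
    by (simp add: fps_mult_nth atLeast0AtMost kaczmarz_coeff_eq[OF assms]) (simp only: mult.commute)
  then have "Abs_fps (kaczmarz_coeff f) = ?\<phi> * ?\<alpha>" by (metis fps_ext)
  then have "Abs_fps (kaczmarz_coeff f) * ?m = ?\<phi>"
    by (simp add: mult.assoc inv_cauchy_coeff_fps)
  then have "fps_nth (Abs_fps (kaczmarz_coeff f) * ?m) n = fps_nth ?\<phi> n" by simp
  then show ?thesis
    by (simp only: fps_mult_nth atLeast0AtMost fps_nth_Abs_fps)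
qed

text \<open>Justifies the name: the next coefficient is the inner product of the current residual
  with the unit vector \<open>fexp (of_nat n)\<close>, so passing to
  \<open>residual f (Suc n)\<close> subtracts an orthogonal projection.\<close>

lemma inner_residual_fexp:
  assumes "square_integrable M f"
  shows "inner_L2 M (residual f n) (fexp (of_nat n)) = kaczmarz_coeff f n"
proof -
  have "inner_L2 M (residual f n) (fexp (of_nat n)) =
      inner_L2 M f (fexp (of_nat n)) - (\<Sum>k<n. kaczmarz_coeff f k * fourier_stieltjes M (of_nat (n - k)))"
  proof -
    have sum: "square_integrable M (\<lambda>x. \<Sum>k<n. kaczmarz_coeff f k * fexp (of_nat k) x)"
      by (intro square_integrable_sum square_integrable_cmult square_integrable_fexp)
    have "inner_L2 M (residual f n) (fexp (of_nat n)) = inner_L2 M f (fexp (of_nat n)) -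
        inner_L2 M (\<lambda>x. \<Sum>k<n. kaczmarz_coeff f k * fexp (of_nat k) x) (fexp (of_nat n))"
      unfolding residual_def by (rule inner_L2_diff_left[OF assms sum square_integrable_fexp])
    then show ?thesis
      by (simp add: inner_L2_sum_left square_integrable_cmult inner_L2_cmult_left inner_fexp_nat)
  qed
  also have "\<dots> = kaczmarz_coeff f n"
    unfolding inner_fexp_kaczmarz[OF assms] by (simp add: lessThan_Suc_atMost [symmetric])
  finally show ?thesis .
qed

lemma residual_0 [simp]: "residual f 0 = f"
  by (auto simp: residual_def)

lemma residual_Suc: "residual f (Suc n) = (\<lambda>x. residual f n x - kaczmarz_coeff f n * fexp (of_nat n) x)"
  by (auto simp: residual_def)

text \<open>Polarised Pythagoras: each projection removes exactly one product of coefficients from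
  the inner product.\<close>

lemma inner_residual:
  assumes f: "square_integrable M f" and h: "square_integrable M h"
  shows "inner_L2 M (residual f n) (residual h n) =
    inner_L2 M f h - (\<Sum>k<n. kaczmarz_coeff f k * cnj (kaczmarz_coeff h k))"
proof (induction n)
  case (Suc n)
  let ?e = "fexp (of_nat n)"
  have [simp]: "inner_L2 M (residual f n) ?e = kaczmarz_coeff f n"
    "inner_L2 M ?e (residual h n) = cnj (kaczmarz_coeff h n)"
    using inner_residual_fexp[OF f] inner_residual_fexp[OF h] by (auto simp: inner_L2_cnj [of M _ ?e, symmetric])
  have [simp]: "inner_L2 M ?e ?e = 1" by (simp add: inner_fexp)
  have si: "square_integrable M (\<lambda>x. c * fexp (of_nat n) x)" for c by blast
  show ?case
    unfolding residual_Suc using f h si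
    by (simp add: inner_L2_diff_left inner_L2_diff_right square_integrable_diff
        inner_L2_cmult_left inner_L2_cmult_right Suc.IH)
qed simp

lemma sqnorm_residual:
  assumes f: "square_integrable M f"
  shows "sqnorm_L2 M (residual f n) = sqnorm_L2 M f - (\<Sum>k<n. (norm (kaczmarz_coeff f k))\<^sup>2)"
proof -
  have "complex_of_real (sqnorm_L2 M (residual f n)) =
      complex_of_real (sqnorm_L2 M f - (\<Sum>k<n. (norm (kaczmarz_coeff f k))\<^sup>2))"
    using inner_residual[OF f f, of n] by (simp add: inner_L2_self complex_norm_square [symmetric])
  then show ?thesis by (simp only: of_real_eq_iff)
qed

text \<open>Residual norms are nonnegative. Arbitrary finite index sets are allowed so that blocks
  \<open>{n..<m}\<close> can be estimated in \<open>dual_synthesis\<close>.\<close>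

lemma Bessel_kaczmarz:
  assumes "square_integrable M f" "finite I"
  shows "(\<Sum>k\<in>I. (norm (kaczmarz_coeff f k))\<^sup>2) \<le> sqnorm_L2 M f"
proof -
  obtain n where "I \<subseteq> {..<n}" using assms(2) finite_nat_iff_bounded by blast
  then have "(\<Sum>k\<in>I. (norm (kaczmarz_coeff f k))\<^sup>2) \<le> (\<Sum>k<n. (norm (kaczmarz_coeff f k))\<^sup>2)"
    by (intro sum_mono2) auto
  then show ?thesis
    using sqnorm_residual[OF assms(1), of n] sqnorm_L2_nonneg[of M "residual f n"] by linarith
qed

lemma sqnorm_residual_le:
  assumes "square_integrable M f"
  shows "sqnorm_L2 M (residual f n) \<le> sqnorm_L2 M f"
  unfolding sqnorm_residual[OF assms] by (simp add: sum_nonneg)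

section \<open>Linearity of the residual and closure properties of convergence\<close>

lemma residual_add:
  assumes "square_integrable M f" "square_integrable M g"
  shows "residual (\<lambda>x. f x + g x) n = (\<lambda>x. residual f n x + residual g n x)"
proof -
  have "kaczmarz_coeff (\<lambda>x. f x + g x) k = kaczmarz_coeff f k + kaczmarz_coeff g k" for k
    using Bochner_Integration.integral_add[OF integrable_mult_cnj[OF assms(1)] integrable_mult_cnj[OF assms(2)],
        OF square_integrable_dual_vector square_integrable_dual_vector]
    by (simp add: kaczmarz_coeff_def inner_L2_def distrib_right)
  then show ?thesis by (auto simp: residual_def distrib_right sum.distrib)
qed

lemma residual_cmult: "residual (\<lambda>x. c * f x) n = (\<lambda>x. c * residual f n x)"
  by (auto simp: residual_def kaczmarz_coeff_def inner_L2_cmult_left right_diff_distrib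
      sum_distrib_left mult.assoc)

text \<open>Taking residuals is a linear contraction, uniformly in \<open>n\<close>, so the
  functions with convergent iteration form a closed set.\<close>

lemma kaczmarz_converges_approx:
  assumes f: "square_integrable M f"
    and approx: "\<And>e. e > 0 \<Longrightarrow> \<exists>p. square_integrable M p \<and> kaczmarz_converges p \<and> sqnorm_L2 M (\<lambda>x. f x - p x) \<le> e"
  shows "kaczmarz_converges f"
  unfolding kaczmarz_converges_def
proof (rule LIMSEQ_I)
  fix e :: real assume e: "e > 0"
  \<comment> \<open>The error and the residual of \<open>p\<close> each enter with factor 2, so
    \<open>e/4\<close> for both gives \<open>e\<close>.\<close>
  obtain p where p: "square_integrable M p" "kaczmarz_converges p" "sqnorm_L2 M (\<lambda>x. f x - p x) \<le> e/4"
    using approx[of "e/4"] e by auto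
  obtain N where N: "\<And>n. n \<ge> N \<Longrightarrow> norm (sqnorm_L2 M (residual p n) - 0) < e/4"
    using LIMSEQ_D[OF p(2)[unfolded kaczmarz_converges_def], of "e/4"] e by auto
  have "norm (sqnorm_L2 M (residual f n) - 0) < e" if n: "n \<ge> N" for n
  proof -
    have d: "square_integrable M (\<lambda>x. f x - p x)" using f p by blast
    have "residual f n = residual (\<lambda>x. (f x - p x) + p x) n" by simp
    also have "\<dots> = (\<lambda>x. residual (\<lambda>x. f x - p x) n x + residual p n x)"
      by (rule residual_add[OF d p(1)])
    finally have "sqnorm_L2 M (residual f n) \<le>
        2 * sqnorm_L2 M (residual (\<lambda>x. f x - p x) n) + 2 * sqnorm_L2 M (residual p n)"
      using sqnorm_L2_add_le[of M "residual (\<lambda>x. f x - p x) n" "residual p n"] d p by simp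
    with sqnorm_residual_le[OF d, of n] p(3) N[OF n] show ?thesis by simp
  qed
  then show "\<exists>N. \<forall>n\<ge>N. norm (sqnorm_L2 M (residual f n) - 0) < e" by blast
qed

lemma kaczmarz_converges_add:
  assumes f: "square_integrable M f" "kaczmarz_converges f"
    and g: "square_integrable M g" "kaczmarz_converges g"
  shows "kaczmarz_converges (\<lambda>x. f x + g x)"
  unfolding kaczmarz_converges_def
proof (rule Lim_null_comparison)
  show "\<forall>\<^sub>F n in sequentially. norm (sqnorm_L2 M (residual (\<lambda>x. f x + g x) n)) \<le>
      2 * sqnorm_L2 M (residual f n) + 2 * sqnorm_L2 M (residual g n)"
    unfolding residual_add[OF f(1) g(1)] using f g by (simp add: sqnorm_L2_add_le)
  have "(\<lambda>n. 2 * sqnorm_L2 M (residual f n) + 2 * sqnorm_L2 M (residual g n)) \<longlonglongrightarrow> 2 * 0 + 2 * 0"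
    using f(2) g(2) unfolding kaczmarz_converges_def by (intro tendsto_intros)
  then show "(\<lambda>n. 2 * sqnorm_L2 M (residual f n) + 2 * sqnorm_L2 M (residual g n)) \<longlonglongrightarrow> 0" by simp
qed

lemma kaczmarz_converges_cmult:
  "kaczmarz_converges f \<Longrightarrow> kaczmarz_converges (\<lambda>x. c * f x)"
  unfolding kaczmarz_converges_def residual_cmult sqnorm_L2_cmult
  by (rule tendsto_mult_right_zero)

section \<open>Stationarity and integral frequencies\<close>

lemma inv_cauchy_coeff_0 [simp]: "inv_cauchy_coeff M 0 = 1"
  using inv_cauchy_coeff_convolution[of 0] by simp

text \<open>The convolution relation at \<open>Suc n\<close> with its \<open>j = 0\<close> term
  moved to the right, where the zeroth moment is 1.\<close>

lemma inv_cauchy_coeff_convolution_Suc: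
  "(\<Sum>j\<le>n. inv_cauchy_coeff M (n - j) * fourier_stieltjes M (of_nat (Suc j))) = - inv_cauchy_coeff M (Suc n)"
  using inv_cauchy_coeff_convolution[of "Suc n"]
  by (simp add: sum.atMost_Suc_shift add_eq_0_iff del: sum.atMost_Suc of_nat_Suc)

text \<open>Since the exponentials are the orbit of the constant function under a unitary operator,
  the first step of the algorithm followed by a rotation shifts the whole iteration.\<close>

lemma kaczmarz_shift:
  assumes f: "square_integrable M f"
  defines "Af \<equiv> \<lambda>x. fexp (- 1) x * (f x - inner_L2 M f (fexp 0))"
  shows "square_integrable M Af" "kaczmarz_coeff Af n = kaczmarz_coeff f (Suc n)"
    "kaczmarz_converges Af \<longleftrightarrow> kaczmarz_converges f"
proof -
  let ?c = "inner_L2 M f (fexp 0)"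
  have c: "kaczmarz_coeff f 0 = ?c" by (simp add: kaczmarz_coeff_eq[OF f])
  have one: "square_integrable M (\<lambda>_. ?c)"
    using square_integrable_cmult[OF square_integrable_fexp[of 0], of ?c] by simp
  have res: "residual f 1 = (\<lambda>x. f x - ?c)" by (auto simp: residual_def c)
  show Af: "square_integrable M Af"
    unfolding Af_def
    by (rule square_integrable_mult_bounded[where B = 1]) (use f one in auto)
  have inner: "inner_L2 M Af (fexp (of_nat j)) =
      inner_L2 M f (fexp (of_nat (Suc j))) - ?c * fourier_stieltjes M (of_nat (Suc j))" for j
  proof -
    \<comment> \<open>Moving the rotation to the second argument raises the frequency by
      one.\<close>
    have "inner_L2 M Af (fexp (of_nat j)) = inner_L2 M (\<lambda>x. f x - ?c) (fexp (of_nat (Suc j)))"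
      unfolding inner_L2_def Af_def
      by (intro Bochner_Integration.integral_cong refl) (simp add: cnj_fexp fexp_add [symmetric] algebra_simps)
    also have "\<dots> = inner_L2 M f (fexp (of_nat (Suc j))) - inner_L2 M (\<lambda>x. ?c * fexp 0 x) (fexp (of_nat (Suc j)))"
      using f one by (simp add: inner_L2_diff_left)
    finally show ?thesis by (simp add: inner_L2_cmult_left inner_fexp del: fexp_0)
  qed
  show coeff: "kaczmarz_coeff Af n = kaczmarz_coeff f (Suc n)" for n
  proof -
    have "kaczmarz_coeff Af n =
        (\<Sum>j\<le>n. inv_cauchy_coeff M (n - j) * inner_L2 M f (fexp (of_nat (Suc j)))) -
        ?c * (\<Sum>j\<le>n. inv_cauchy_coeff M (n - j) * fourier_stieltjes M (of_nat (Suc j)))"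
      unfolding kaczmarz_coeff_eq[OF Af] inner sum_distrib_left sum_subtractf [symmetric]
      by (simp add: algebra_simps)
    \<comment> \<open>The second sum equals \<open>- inv_cauchy_coeff M (Suc n)\<close>, so
      subtracting it supplies precisely the missing \<open>j = 0\<close> term.\<close>
    also have "\<dots> = kaczmarz_coeff f (Suc n)"
      unfolding inv_cauchy_coeff_convolution_Suc kaczmarz_coeff_eq[OF f, of "Suc n"]
      by (simp add: sum.atMost_Suc_shift mult.commute del: sum.atMost_Suc of_nat_Suc)
    finally show ?thesis .
  qed
  \<comment> \<open>The rotation is unimodular. Equal starting norms and shifted coefficients then
    give equal residual norms, with an index shift of one.\<close>
  have "sqnorm_L2 M Af = sqnorm_L2 M (residual f 1)"
    unfolding res Af_def by (simp add: sqnorm_L2_def norm_mult)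
  also have "\<dots> = sqnorm_L2 M f - (norm (kaczmarz_coeff f 0))\<^sup>2"
    by (simp add: sqnorm_residual[OF f])
  finally have "sqnorm_L2 M (residual Af n) = sqnorm_L2 M (residual f (Suc n))" for n
    unfolding sqnorm_residual[OF f] sqnorm_residual[OF Af] coeff
    by (simp add: sum.lessThan_Suc_shift del: sum.lessThan_Suc)
  then show "kaczmarz_converges Af \<longleftrightarrow> kaczmarz_converges f"
    unfolding kaczmarz_converges_def using filterlim_sequentially_Suc[of "\<lambda>n. sqnorm_L2 M (residual f n)"] by simp
qed

text \<open>The inner products of \<open>fexp (- 1)\<close> with \<open>fexp (of_nat j)\<close> are
  the moments of index \<open>j + 1\<close>, so its coefficients are
  \<open>- inv_cauchy_coeff M (Suc k)\<close>. Convergence for this one function thus becomes the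
  statement that their squares sum to 1.\<close>

lemma sqnorm_residual_fexp_minus_one:
  "sqnorm_L2 M (residual (fexp (- 1)) n) = 1 - (\<Sum>k<n. (norm (inv_cauchy_coeff M (Suc k)))\<^sup>2)"
proof -
  have "kaczmarz_coeff (fexp (- 1)) k = - inv_cauchy_coeff M (Suc k)" for k
    unfolding kaczmarz_coeff_eq[OF square_integrable_fexp]
    using inv_cauchy_coeff_convolution_Suc[of k] by (simp add: inner_fexp add.commute)
  moreover have "sqnorm_L2 M (fexp (- 1)) = 1" by (simp add: sqnorm_L2_def prob_space)
  ultimately show ?thesis by (simp add: sqnorm_residual)
qed

text \<open>The shift sends \<open>fexp w\<close> to \<open>fexp (w - 1)\<close> minus a multiple of
  \<open>fexp (- 1)\<close>. As the latter converges, convergence passes between \<open>w\<close>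
  and \<open>w - 1\<close> in both directions, and induction runs up and down from -1.\<close>

lemma kaczmarz_converges_fexp_int:
  assumes m1: "kaczmarz_converges (fexp (- 1))"
  shows "kaczmarz_converges (fexp (of_int k))"
proof -
  have shift: "kaczmarz_converges (fexp (w - 1)) \<longleftrightarrow> kaczmarz_converges (fexp w)" for w
  proof -
    let ?c = "inner_L2 M (fexp w) (fexp 0)"
    have A: "kaczmarz_converges (\<lambda>x. fexp (- 1) x * (fexp w x - ?c)) \<longleftrightarrow> kaczmarz_converges (fexp w)"
      by (rule kaczmarz_shift) simp
    have eq: "(\<lambda>x. fexp (- 1) x * (fexp w x - ?c)) = (\<lambda>x. fexp (w - 1) x + (- ?c) * fexp (- 1) x)"
      by (auto simp: algebra_simps fexp_add [symmetric])
    have eq': "fexp (w - 1) = (\<lambda>x. (fexp (w - 1) x + (- ?c) * fexp (- 1) x) + ?c * fexp (- 1) x)" by auto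
    have c: "kaczmarz_converges (\<lambda>x. d * fexp (- 1) x)" "square_integrable M (\<lambda>x. d * fexp (- 1) x)" for d
      using kaczmarz_converges_cmult[OF m1] by blast+
    have "kaczmarz_converges (fexp (w - 1)) \<longleftrightarrow> kaczmarz_converges (\<lambda>x. fexp (w - 1) x + (- ?c) * fexp (- 1) x)"
    proof
      assume "kaczmarz_converges (fexp (w - 1))"
      then show "kaczmarz_converges (\<lambda>x. fexp (w - 1) x + (- ?c) * fexp (- 1) x)"
        by (intro kaczmarz_converges_add c) auto
    next
      assume "kaczmarz_converges (\<lambda>x. fexp (w - 1) x + (- ?c) * fexp (- 1) x)"
      then show "kaczmarz_converges (fexp (w - 1))"
        using kaczmarz_converges_add[OF square_integrable_add[OF square_integrable_fexp c(2)] _ c(2) c(1)]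
        by (subst eq') blast
    qed
    then show ?thesis using A unfolding eq by simp
  qed
  show ?thesis
  proof (induction k rule: int_induct[where k = "-1"])
    case base then show ?case using m1 by simp
  next
    case (step1 i) then show ?case using shift[of "of_int i + 1"] by simp
  next
    case (step2 i) then show ?case using shift[of "of_int i"] by simp
  qed
qed

text \<open>Convergence is required of \<open>h\<close> only: the residual of \<open>f\<close> stays
  bounded, so Cauchy-Schwarz sends the inner product of the two residuals to 0.\<close>

lemma kaczmarz_expansion:
  assumes f: "square_integrable M f" and h: "square_integrable M h" "kaczmarz_converges h"
  shows "(\<lambda>n. kaczmarz_coeff f n * cnj (kaczmarz_coeff h n)) sums inner_L2 M f h"
proof -
  have "(\<lambda>n. (norm (inner_L2 M (residual f n) (residual h n)))\<^sup>2) \<longlonglongrightarrow> 0"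
  proof (rule Lim_null_comparison)
    have "(norm (inner_L2 M (residual f n) (residual h n)))\<^sup>2 \<le> sqnorm_L2 M f * sqnorm_L2 M (residual h n)" for n
      using Cauchy_Schwarz_L2[of M "residual f n" "residual h n"] f h
        mult_right_mono[OF sqnorm_residual_le[OF f, of n] sqnorm_L2_nonneg[of M "residual h n"]] by auto
    then show "\<forall>\<^sub>F n in sequentially. norm ((norm (inner_L2 M (residual f n) (residual h n)))\<^sup>2) \<le>
        sqnorm_L2 M f * sqnorm_L2 M (residual h n)" by simp
    show "(\<lambda>n. sqnorm_L2 M f * sqnorm_L2 M (residual h n)) \<longlonglongrightarrow> 0"
      using h(2) unfolding kaczmarz_converges_def by (rule tendsto_mult_right_zero)
  qed
  then have "(\<lambda>n. inner_L2 M (residual f n) (residual h n)) \<longlonglongrightarrow> 0"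
    by (simp add: tendsto_norm_zero_iff)
  then have "(\<lambda>n. inner_L2 M f h - inner_L2 M (residual f n) (residual h n)) \<longlonglongrightarrow> inner_L2 M f h - 0"
    by (intro tendsto_intros)
  then show ?thesis
    unfolding sums_def inner_residual[OF f h(1)] by simp
qed

text \<open>Synthesis is adjoint to analysis, so Bessel bounds it too: the squared norm of the sum
  \<open>h\<close> is at most half the square sum of \<open>c\<close> plus half that of the
  coefficients of \<open>h\<close>, and the latter half is absorbed by the left side.\<close>

lemma sqnorm_dual_sum_le:
  assumes I: "finite I"
  shows "sqnorm_L2 M (\<lambda>x. \<Sum>k\<in>I. c k * dual_vector k x) \<le> (\<Sum>k\<in>I. (norm (c k))\<^sup>2)"
proof -
  define h where "h = (\<lambda>x. \<Sum>k\<in>I. c k * dual_vector k x)"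
  have h: "square_integrable M h"
    unfolding h_def by (intro square_integrable_sum square_integrable_cmult square_integrable_dual_vector)
  have "inner_L2 M h h = (\<Sum>k\<in>I. c k * inner_L2 M (dual_vector k) h)"
    by (subst (1) h_def, subst inner_L2_sum_left) (use h in \<open>auto simp: inner_L2_cmult_left\<close>)
  also have "\<dots> = (\<Sum>k\<in>I. c k * cnj (kaczmarz_coeff h k))"
    by (simp add: kaczmarz_coeff_def inner_L2_cnj)
  finally have "sqnorm_L2 M h = norm (\<Sum>k\<in>I. c k * cnj (kaczmarz_coeff h k))"
    unfolding inner_L2_self by (metis abs_of_nonneg norm_of_real sqnorm_L2_nonneg)
  also have "\<dots> \<le> (\<Sum>k\<in>I. ((norm (c k))\<^sup>2 + (norm (kaczmarz_coeff h k))\<^sup>2) / 2)"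
    by (intro sum_norm_le norm_mult_cnj_le)
  also have "\<dots> = ((\<Sum>k\<in>I. (norm (c k))\<^sup>2) + (\<Sum>k\<in>I. (norm (kaczmarz_coeff h k))\<^sup>2)) / 2"
    by (simp add: sum_divide_distrib sum.distrib add_divide_distrib)
  finally show ?thesis
    using Bessel_kaczmarz[OF h I] by (simp add: h_def)
qed

text \<open>By \<open>sqnorm_dual_sum_le\<close> the partial sums are Cauchy in L2, and their limit
  is tested against \<open>h\<close> by Cauchy-Schwarz.\<close>

lemma dual_synthesis:
  assumes c: "summable (\<lambda>n. (norm (c n))\<^sup>2)"
  obtains f where "square_integrable M f"
    "\<And>h. square_integrable M h \<Longrightarrow> (\<lambda>n. c n * inner_L2 M (dual_vector n) h) sums inner_L2 M f h"
proof -
  define s where "s n x = (\<Sum>k<n. c k * dual_vector k x)" for n x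
  have s: "square_integrable M (s n)" for n
    unfolding s_def by (intro square_integrable_sum square_integrable_cmult square_integrable_dual_vector)
  have tail: "sqnorm_L2 M (\<lambda>x. s m x - s n x) \<le> (\<Sum>k\<in>{n..<m}. (norm (c k))\<^sup>2)" if "n \<le> m" for m n
  proof -
    have "(\<lambda>x. s m x - s n x) = (\<lambda>x. \<Sum>k\<in>{n..<m}. c k * dual_vector k x)"
      using that by (simp add: fun_eq_iff s_def sum_diff_nat_ivl flip: atLeast0LessThan)
    then show ?thesis using sqnorm_dual_sum_le by simp
  qed
  have sym: "sqnorm_L2 M (\<lambda>x. s m x - s n x) = sqnorm_L2 M (\<lambda>x. s n x - s m x)" for m n
    by (simp add: sqnorm_L2_def norm_minus_commute)
  obtain f where f: "square_integrable M f" "(\<lambda>n. sqnorm_L2 M (\<lambda>x. s n x - f x)) \<longlonglongrightarrow> 0"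
  proof (rule L2_complete[OF s])
    fix e :: real assume "e > 0"
    then obtain N where N: "\<And>m n. m \<ge> N \<Longrightarrow> norm (\<Sum>k\<in>{m..<n}. (norm (c k))\<^sup>2) < e"
      using c unfolding summable_Cauchy by blast
    have le: "sqnorm_L2 M (\<lambda>x. s m x - s n x) \<le> e" if "N \<le> n" "n \<le> m" for m n
      using tail[OF that(2)] N[OF that(1), of m] by (auto simp: abs_of_nonneg sum_nonneg)
    have "sqnorm_L2 M (\<lambda>x. s m x - s n x) \<le> e" if "N \<le> n" "N \<le> m" for m n
      using le[of n m] le[of m n] sym[of m n] that by (cases "n \<le> m") auto
    then show "\<exists>N. \<forall>m\<ge>N. \<forall>n\<ge>N. sqnorm_L2 M (\<lambda>x. s m x - s n x) \<le> e" by blast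
  qed
  show thesis
  proof (rule that[OF f(1)])
    fix h assume h: "square_integrable M h"
    have "(\<lambda>n. (norm (inner_L2 M (\<lambda>x. s n x - f x) h))\<^sup>2) \<longlonglongrightarrow> 0"
    proof (rule Lim_null_comparison)
      show "\<forall>\<^sub>F n in sequentially. norm ((norm (inner_L2 M (\<lambda>x. s n x - f x) h))\<^sup>2) \<le>
          sqnorm_L2 M (\<lambda>x. s n x - f x) * sqnorm_L2 M h"
        using Cauchy_Schwarz_L2[OF square_integrable_diff[OF s f(1)] h] by simp
      show "(\<lambda>n. sqnorm_L2 M (\<lambda>x. s n x - f x) * sqnorm_L2 M h) \<longlonglongrightarrow> 0"
        using f(2) by (rule tendsto_mult_left_zero)
    qed
    then have "(\<lambda>n. inner_L2 M (\<lambda>x. s n x - f x) h + inner_L2 M f h) \<longlonglongrightarrow> 0 + inner_L2 M f h"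
      by (intro tendsto_intros) (simp add: tendsto_norm_zero_iff)
    moreover have "inner_L2 M (s n) h = (\<Sum>k<n. c k * inner_L2 M (dual_vector k) h)" for n
      unfolding s_def inner_L2_sum_left[OF square_integrable_cmult[OF square_integrable_dual_vector] h]
        inner_L2_cmult_left ..
    then have "inner_L2 M (\<lambda>x. s n x - f x) h + inner_L2 M f h = (\<Sum>k<n. c k * inner_L2 M (dual_vector k) h)" for n
      using inner_L2_diff_left[OF s f(1) h] by simp
    ultimately show "(\<lambda>n. c n * inner_L2 M (dual_vector n) h) sums inner_L2 M f h"
      by (simp add: sums_def)
  qed
qed

end

section \<open>Singularity and the Poisson integral\<close>

abbreviation (input) circle_lebesgue :: "real measure" where
  "circle_lebesgue \<equiv> restrict_space lborel circle"

section \<open>Fourier series for Lebesgue measure on the circle\<close>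

lemma emeasure_circle_lebesgue: "emeasure circle_lebesgue circle = 1"
  by (subst emeasure_restrict_space) (auto simp: circle_def)

text \<open>Lebesgue measure is itself an instance, so the facts about exponentials can be reused
  for it.\<close>

interpretation L: circle_measure circle_lebesgue
proof (intro circle_measure.intro prob_spaceI circle_measure_axioms.intro)
  show "emeasure circle_lebesgue (space circle_lebesgue) = 1"
    using emeasure_circle_lebesgue by (simp add: space_restrict_space)
  show "sets circle_lebesgue = sets (restrict_space borel circle)"
    by (simp add: sets_restrict_space)
qed

lemma fourier_stieltjes_circle_lebesgue:
  "fourier_stieltjes circle_lebesgue (of_int k) = (if k = 0 then 1 else 0)"
proof (cases "k = 0")
  case False
  define F where "F x = - fexp (- of_int k) x / (2 * of_real pi * \<i> * of_int k)" for x
  have nz: "2 * of_real pi * \<i> * of_int k \<noteq> (0::complex)" using False by simp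
  have "(F has_vector_derivative fexp (- of_int k) x) (at x within A)" for x A
  proof -
    define c where "c = 2 * of_real pi * \<i> * of_int k"
    have "((\<lambda>z. - exp (- c * z) / c) has_field_derivative exp (- c * of_real x)) (at (of_real x))"
      using nz by (auto intro!: derivative_eq_intros simp: c_def)
    from has_vector_derivative_real_field[OF this, of A] show ?thesis
      by (simp add: F_def [abs_def] fexp_def c_def mult.assoc)
  qed
  then have "(\<integral>x. indicator {-1/2..1/2} x *\<^sub>R fexp (- of_int k) x \<partial>lborel) = F (1/2) - F (-1/2)"
    by (intro integral_FTC_Icc continuous_intros) auto
  also have "fexp (- of_int k) (1/2) = fexp (- of_int k) (-1/2)"
  proof -
    have "fexp (- of_int k) (1/2) = fexp (- of_int k) (-1/2) * exp (2 * of_real pi * \<i> * of_int (- k))"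
      by (simp add: fexp_def exp_add [symmetric] algebra_simps)
    also have "exp (2 * of_real pi * \<i> * of_int (- k)) = 1"
      using exp_integer_2pi[of "of_int (-k)"] by (simp add: mult.commute mult.left_commute)
    finally show ?thesis by simp
  qed
  then have "F (1/2) - F (-1/2) = 0" by (simp add: F_def)
  also have "(\<integral>x. indicator {-1/2..1/2} x *\<^sub>R fexp (- of_int k) x \<partial>lborel) =
      (\<integral>x. indicator circle x *\<^sub>R fexp (- of_int k) x \<partial>lborel)"
  proof (rule integral_cong_AE)
    have "AE x in lborel. x \<noteq> (-1/2::real)" "AE x in lborel. x \<noteq> (1/2::real)"
      by (rule AE_lborel_singleton)+
    then show "AE x in lborel. indicator {-1/2..1/2} x *\<^sub>R fexp (- of_int k) x =
        indicator circle x *\<^sub>R fexp (- of_int k) x"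
      by eventually_elim (auto simp: circle_def indicator_def)
  qed (simp_all add: circle_def)
  also have "\<dots> = fourier_stieltjes circle_lebesgue (of_int k)"
    unfolding L.fourier_stieltjes_conv_fexp
    by (rule integral_restrict_space [symmetric]) (simp add: circle_def)
  finally show ?thesis using False by simp
qed simp

lemma sqnorm_trig_polynomial:
  "sqnorm_L2 circle_lebesgue (\<lambda>x. \<Sum>n<N. c n * fexp (of_nat n) x) = (\<Sum>n<N. (norm (c n))\<^sup>2)"
proof -
  have orth: "inner_L2 circle_lebesgue (fexp (of_nat m)) (fexp (of_nat n)) = (if m = n then 1 else 0)" for m n
    using fourier_stieltjes_circle_lebesgue[of "int n - int m"] by (simp add: L.inner_fexp)
  have si: "square_integrable circle_lebesgue (\<lambda>x. c n * fexp (of_nat n) x)" for n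
    by (intro square_integrable_cmult L.square_integrable_fexp)
  have "complex_of_real (sqnorm_L2 circle_lebesgue (\<lambda>x. \<Sum>n<N. c n * fexp (of_nat n) x)) =
      (\<Sum>m<N. \<Sum>n<N. inner_L2 circle_lebesgue (\<lambda>x. c m * fexp (of_nat m) x) (\<lambda>x. c n * fexp (of_nat n) x))"
    unfolding inner_L2_self [symmetric]
    by (simp add: inner_L2_sum_left[OF si square_integrable_sum[OF si]] inner_L2_sum_right[OF si si])
  also have "\<dots> = (\<Sum>m<N. of_real ((norm (c m))\<^sup>2))"
    by (simp add: inner_L2_cmult_left inner_L2_cmult_right orth if_distrib sum.If_cases
        complex_norm_square [symmetric] mult.commute cong: if_cong)
  finally show ?thesis
    by (simp only: of_real_sum [symmetric] of_real_eq_iff)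
qed

text \<open>Absolute convergence gives one constant dominating all partial sums, so the polynomial
  case passes to the limit.\<close>

lemma Parseval_absolutely_convergent:
  assumes c: "summable (\<lambda>n. norm (c n))"
  shows "(\<lambda>n. (norm (c n))\<^sup>2) sums sqnorm_L2 circle_lebesgue (\<lambda>x. \<Sum>n. c n * fexp (of_nat n) x)"
  unfolding sums_def sqnorm_trig_polynomial [symmetric] unfolding sqnorm_L2_def
proof (rule integral_dominated_convergence)
  have sm: "summable (\<lambda>n. norm (c n * fexp (of_nat n) x))" for x
    using c by (simp add: norm_mult)
  show "integrable circle_lebesgue (\<lambda>x. (\<Sum>n. norm (c n))\<^sup>2)"
    by (rule L.integrable_const)
  show "AE x in circle_lebesgue. (\<lambda>N. (norm (\<Sum>n<N. c n * fexp (of_nat n) x))\<^sup>2)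
      \<longlonglongrightarrow> (norm (\<Sum>n. c n * fexp (of_nat n) x))\<^sup>2"
    by (intro AE_I2 tendsto_intros summable_LIMSEQ summable_norm_cancel[OF sm])
  have "norm (\<Sum>n<N. c n * fexp (of_nat n) x) \<le> (\<Sum>n. norm (c n))" for N x
  proof -
    have "norm (\<Sum>n<N. c n * fexp (of_nat n) x) \<le> (\<Sum>n<N. norm (c n))"
      by (rule sum_norm_le) (simp add: norm_mult)
    also have "\<dots> \<le> (\<Sum>n. norm (c n))"
      by (rule sum_le_suminf[OF c]) auto
    finally show ?thesis .
  qed
  then show "AE x in circle_lebesgue. norm ((norm (\<Sum>n<N. c n * fexp (of_nat n) x))\<^sup>2) \<le> (\<Sum>n. norm (c n))\<^sup>2" for N
    by (auto intro!: power_mono)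
qed measurable

section \<open>The Poisson kernel on the circle of radius \<open>r\<close>\<close>

definition poisson :: "real \<Rightarrow> real \<Rightarrow> real \<Rightarrow> real" where
  "poisson r x t = disc_poisson (of_real r * fexp 1 t * fexp (- 1) x)"

lemma poisson_nonneg: "0 \<le> r \<Longrightarrow> r < 1 \<Longrightarrow> poisson r x t \<ge> 0"
  unfolding poisson_def by (rule disc_poisson_nonneg) (simp add: norm_mult)

lemma poisson_eq: "0 \<le> r \<Longrightarrow> poisson r x t = (1 - r\<^sup>2) / (norm (1 - of_real r * fexp 1 t * fexp (- 1) x))\<^sup>2"
  by (simp add: poisson_def disc_poisson_def norm_mult)

text \<open>Away from the pole the kernel is of order \<open>1 - r\<^sup>2\<close>. With
  \<open>u\<close> unimodular, \<open>norm (1 - u)\<close> is at most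
  \<open>norm (1 - r u) + (1 - r)\<close>, hence at most twice the first summand; squaring gives the
  factor 4.\<close>

lemma poisson_le:
  assumes r: "0 \<le> r" "r < 1" and d: "d > 0" "d \<le> norm (1 - fexp 1 t * fexp (- 1) x)"
  shows "poisson r x t \<le> 4 * (1 - r\<^sup>2) / d\<^sup>2"
proof -
  define u where "u = fexp 1 t * fexp (- 1) x"
  have u: "norm u = 1" by (simp add: u_def norm_mult)
  have "1 - r \<le> norm (1 - of_real r * u)"
    using norm_triangle_ineq2[of 1 "of_real r * u"] r u by (simp add: norm_mult)
  moreover have "norm (1 - u) \<le> norm (1 - of_real r * u) + norm (of_real r * u - u)"
    using norm_triangle_ineq[of "1 - of_real r * u" "of_real r * u - u"] by simp
  moreover have "norm (of_real r * u - u) = 1 - r"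
  proof -
    have "of_real r * u - u = of_real (r - 1) * u" by (simp add: algebra_simps)
    then show ?thesis using u r by (simp only: norm_mult norm_of_real) simp
  qed
  ultimately have "d / 2 \<le> norm (1 - of_real r * u)" using d(2) by (simp add: u_def)
  then have "(d / 2)\<^sup>2 \<le> (norm (1 - of_real r * u))\<^sup>2" using d by (intro power_mono) auto
  then have "(1 - r\<^sup>2) / (norm (1 - of_real r * u))\<^sup>2 \<le> (1 - r\<^sup>2) / (d / 2)\<^sup>2"
    using d r by (intro divide_left_mono mult_pos_pos) (auto simp: abs_square_le_1 power_le_one intro: less_le_trans)
  then show ?thesis using r by (simp add: poisson_eq u_def power_divide mult.assoc algebra_simps)
qed

lemma poisson_bound:
  assumes r: "0 \<le> r" "r < 1"
  shows "norm (poisson r x t) \<le> 1 / (1 - r)\<^sup>2"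
proof -
  have "1 - r \<le> norm (1 - of_real r * fexp 1 t * fexp (- 1) x)"
    using norm_triangle_ineq2[of 1 "of_real r * fexp 1 t * fexp (- 1) x"] r by (simp add: norm_mult)
  then have "(1 - r)\<^sup>2 \<le> (norm (1 - of_real r * fexp 1 t * fexp (- 1) x))\<^sup>2" using r by (intro power_mono) auto
  then have "poisson r x t \<le> 1 / (1 - r)\<^sup>2"
    using r unfolding poisson_eq[OF r(1)] by (intro frac_le) (auto simp: power_le_one)
  then show ?thesis using poisson_nonneg[OF r] by simp
qed

text \<open>The kernel is \<open>1 - r\<^sup>2\<close> times the squared modulus of a geometric
  series in \<open>fexp 1 t\<close>, whose mean is the sum of \<open>r ^ (2 * n)\<close> by
  Parseval.\<close>

lemma integral_poisson:
  assumes r: "0 \<le> r" "r < 1"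
  shows "(\<integral>t. poisson r x t \<partial>circle_lebesgue) = 1"
proof -
  define c where "c n = of_real r ^ n * fexp (- of_nat n) x" for n
  have nc: "norm (c n) = r ^ n" for n using r by (simp add: c_def norm_mult norm_power)
  have r2: "norm (r\<^sup>2) < 1" using r by (simp add: abs_square_less_1)
  have "(\<lambda>n. (norm (c n))\<^sup>2) sums sqnorm_L2 circle_lebesgue (\<lambda>t. \<Sum>n. c n * fexp (of_nat n) t)"
    by (rule Parseval_absolutely_convergent) (use r in \<open>simp add: nc\<close>)
  moreover have "(\<lambda>n. (norm (c n))\<^sup>2) sums (1 / (1 - r\<^sup>2))"
    using geometric_sums[OF r2] by (simp add: nc power_mult [symmetric] mult.commute)
  moreover have "(\<Sum>n. c n * fexp (of_nat n) t) = 1 / (1 - of_real r * fexp 1 t * fexp (- 1) x)" for t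
  proof -
    have "(\<lambda>n. (of_real r * fexp 1 t * fexp (- 1) x) ^ n) sums (1 / (1 - of_real r * fexp 1 t * fexp (- 1) x))"
      by (rule geometric_sums) (use r in \<open>simp add: norm_mult\<close>)
    moreover have "(of_real r * fexp 1 t * fexp (- 1) x) ^ n = c n * fexp (of_nat n) t" for n
      using fexp_mult_nat[of n "-1" x] fexp_mult_nat[of n 1 t] by (simp add: c_def power_mult_distrib)
    ultimately show ?thesis by (simp add: sums_iff)
  qed
  ultimately have "sqnorm_L2 circle_lebesgue (\<lambda>t. 1 / (1 - of_real r * fexp 1 t * fexp (- 1) x)) = 1 / (1 - r\<^sup>2)"
    using sums_unique2 by simp
  moreover have "(\<integral>t. poisson r x t \<partial>circle_lebesgue) =
      (1 - r\<^sup>2) * sqnorm_L2 circle_lebesgue (\<lambda>t. 1 / (1 - of_real r * fexp 1 t * fexp (- 1) x))"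
    unfolding poisson_eq[OF r(1)] sqnorm_L2_def
    by (subst Bochner_Integration.integral_mult_right_zero [symmetric]) (simp add: norm_divide power_divide)
  moreover have "1 - r\<^sup>2 \<noteq> 0" using r2 by auto
  ultimately show ?thesis by simp
qed

lemma fexp_eq_1_imp:
  assumes "s \<in> circle" "t \<in> circle" "fexp 1 t * fexp (- 1) s = 1"
  shows "s = t"
proof -
  have "fexp 1 (t - s) = 1" using assms(3) by (simp add: fexp_diff_arg)
  then obtain n :: int where "t - s = of_int n"
    unfolding fexp_def exp_eq_1 by auto
  moreover have "\<bar>t - s\<bar> < 1" using assms by (auto simp: circle_def)
  ultimately have "n = 0" by linarith
  with \<open>t - s = of_int n\<close> show ?thesis by simp
qed

section \<open>Poisson integrals of a singular measure\<close>

context circle_measure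
begin

lemma measurable_poisson [measurable]:
  "(\<lambda>(x, t). poisson r x t) \<in> borel_measurable (M \<Otimes>\<^sub>M circle_lebesgue)"
  "(\<lambda>x. poisson r x t) \<in> borel_measurable M"
  "(\<lambda>t. poisson r x t) \<in> borel_measurable circle_lebesgue"
  unfolding poisson_def disc_poisson_def case_prod_beta by measurable

lemma circle_borel: "circle \<in> sets borel"
  by (simp add: circle_def)

text \<open>Inner regularity replaces the Lebesgue-null set carrying \<open>M\<close> by a compact
  subset carrying almost all of the mass.\<close>

lemma singular_compact_support:
  assumes sing: "mutually_singular M circle_lebesgue" and e: "e > 0"
  obtains K where "compact K" "K \<subseteq> circle" "K \<in> sets M" "emeasure circle_lebesgue K = 0" "prob (circle - K) < e"
proof -
  obtain A where A: "A \<in> sets M" "emeasure circle_lebesgue A = 0" "emeasure M (circle - A) = 0"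
    using sing unfolding mutually_singular_def space_M by blast
  have A_circle: "A \<subseteq> circle" using sets.sets_into_space[OF A(1)] by (simp add: space_M)
  have sets_iff: "B \<in> sets M \<longleftrightarrow> B \<in> sets borel \<and> B \<subseteq> circle" for B
    unfolding sets_M using circle_borel by (auto simp: sets_restrict_space_iff)
  have A_borel: "A \<in> sets borel" using A(1) sets_iff by blast
  have probA: "prob A = 1"
    using A(1,3) prob_compl[OF A(1)] by (simp add: space_M measure_def)
  \<comment> \<open>Inner regularity is stated for Borel measures on the whole line, so
    \<open>M\<close> is pushed forward there.\<close>
  let ?D = "distr M borel (\<lambda>x. x)"
  have D: "emeasure ?D B = emeasure M B" if "B \<in> sets M" for B
    using that sets_iff[of B] by (subst emeasure_distr) (auto simp: space_M intro!: arg_cong[where f = "emeasure M"])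
  have "emeasure ?D (space ?D) \<noteq> \<infinity>"
    by (subst emeasure_distr) (auto simp: emeasure_eq_measure)
  then have "emeasure ?D A = (SUP K \<in> {K. K \<subseteq> A \<and> compact K}. emeasure ?D K)"
    by (intro inner_regular A_borel) auto
  moreover have "emeasure ?D A = 1" using D[OF A(1)] probA by (simp add: emeasure_eq_measure)
  moreover have "ennreal (1 - e) < 1" using e by simp
  ultimately have "ennreal (1 - e) < (SUP K \<in> {K. K \<subseteq> A \<and> compact K}. emeasure ?D K)"
    by metis
  then obtain K where K: "K \<subseteq> A" "compact K" "ennreal (1 - e) < emeasure ?D K"
    unfolding less_SUP_iff by blast
  have K_M: "K \<in> sets M" using K A_circle sets_iff[of K] by (auto intro: borel_compact)
  \<comment> \<open>If \<open>1 - e\<close> is negative, \<open>ennreal\<close> has truncated it to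
    0 and the bound holds because probabilities are nonnegative.\<close>
  have "1 - e < prob K"
    using K(3) D[OF K_M] by (auto simp: emeasure_eq_measure ennreal_less_iff split: if_splits)
       (smt (verit) ennreal_neg ennreal_less_iff measure_nonneg)
  moreover have "prob (circle - K) = 1 - prob K"
    using prob_compl[OF K_M] by (simp add: space_M)
  moreover have "emeasure circle_lebesgue K = 0"
    using emeasure_mono[OF K(1), of circle_lebesgue] A L.sets_M sets_M by simp
  ultimately show thesis using that K A_circle K_M by auto
qed

text \<open>Compactness keeps the poles in \<open>K\<close> at a positive distance from
  \<open>t\<close>, so \<open>poisson_le\<close> is uniform over \<open>K\<close>.\<close>

lemma poisson_integral_tendsto_0:
  assumes K: "compact K" "K \<subseteq> circle" "K \<in> sets M" and t: "t \<in> circle - K"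
    and r: "\<And>n. 0 \<le> r n" "\<And>n. r n < 1" "r \<longlonglongrightarrow> 1"
  shows "(\<lambda>n. \<integral>x. indicator K x * poisson (r n) x t \<partial>M) \<longlonglongrightarrow> 0"
proof -
  let ?g = "\<lambda>x. norm (1 - fexp 1 t * fexp (- 1) x)"
  obtain d where d: "d > 0" "\<And>x. x \<in> K \<Longrightarrow> d \<le> ?g x"
  proof (cases "K = {}")
    case False
    have "continuous_on K ?g" by (intro continuous_intros)
    then obtain y where y: "y \<in> K" "\<And>x. x \<in> K \<Longrightarrow> ?g y \<le> ?g x"
      using continuous_attains_inf[OF K(1) False] by blast
    have "?g y \<noteq> 0"
    proof
      assume "?g y = 0"
      then have "y = t" using y(1) K t by (intro fexp_eq_1_imp) auto
      with y t show False by simp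
    qed
    then show thesis using y that[of "?g y"] by simp
  qed (use that[of 1] in auto)
  show ?thesis
  proof (rule Lim_null_comparison)
    have "norm (\<integral>x. indicator K x * poisson (r n) x t \<partial>M) \<le> 4 * (1 - (r n)\<^sup>2) / d\<^sup>2" for n
    proof -
      have nn: "poisson (r n) x t \<ge> 0" for x by (rule poisson_nonneg) (use r in auto)
      have "1 - (r n)\<^sup>2 \<ge> 0" using r by (simp add: power_le_one less_imp_le)
      then have le: "indicator K x * poisson (r n) x t \<le> 4 * (1 - (r n)\<^sup>2) / d\<^sup>2" for x
        using poisson_le[OF r(1) r(2) d(1) d(2), of x n] by (auto simp: indicator_def)
      have "norm (\<integral>x. indicator K x * poisson (r n) x t \<partial>M) = (\<integral>x. indicator K x * poisson (r n) x t \<partial>M)"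
        using nn by (simp add: Bochner_Integration.integral_nonneg)
      also have "\<dots> \<le> 4 * (1 - (r n)\<^sup>2) / d\<^sup>2"
      proof (rule integral_le_const)
        show "integrable M (\<lambda>x. indicator K x * poisson (r n) x t)"
          using le nn K(3) by (intro integrable_bounded_circle[where B = "4 * (1 - (r n)\<^sup>2) / d\<^sup>2"]
            borel_measurable_times borel_measurable_indicator) auto
      qed (use le in auto)
      finally show ?thesis .
    qed
    then show "\<forall>\<^sub>F n in sequentially. norm (\<integral>x. indicator K x * poisson (r n) x t \<partial>M) \<le> 4 * (1 - (r n)\<^sup>2) / d\<^sup>2"
      by simp
    have "(\<lambda>n. 4 * (1 - (r n)\<^sup>2) / d\<^sup>2) \<longlonglongrightarrow> 4 * (1 - 1\<^sup>2) / d\<^sup>2"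
      using d(1) by (intro tendsto_intros r) auto
    then show "(\<lambda>n. 4 * (1 - (r n)\<^sup>2) / d\<^sup>2) \<longlonglongrightarrow> 0" by simp
  qed
qed

text \<open>Fubini, with the integral over \<open>t\<close> done first by
  \<open>integral_poisson\<close>.\<close>

lemma integral_poisson_integral:
  assumes r: "0 \<le> r" "r < 1" and B: "B \<in> sets M"
  shows "(\<integral>t. (\<integral>x. indicator B x * poisson r x t \<partial>M) \<partial>circle_lebesgue) = prob B"
    and "integrable circle_lebesgue (\<lambda>t. \<integral>x. indicator B x * poisson r x t \<partial>M)"
proof -
  interpret P: pair_prob_space M circle_lebesgue ..
  note [measurable] = B
  have int: "integrable (M \<Otimes>\<^sub>M circle_lebesgue) (\<lambda>(x, t). indicator B x * poisson r x t)"
    by (rule P.integrable_const_bound[where B = "1 / (1 - r)\<^sup>2"])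
       (use poisson_bound[OF r] r in \<open>auto simp: indicator_def\<close>)
  show "integrable circle_lebesgue (\<lambda>t. \<integral>x. indicator B x * poisson r x t \<partial>M)"
    using P.integrable_snd[OF int] by simp
  have "(\<integral>t. (\<integral>x. indicator B x * poisson r x t \<partial>M) \<partial>circle_lebesgue) =
      (\<integral>x. (\<integral>t. indicator B x * poisson r x t \<partial>circle_lebesgue) \<partial>M)"
    using P.Fubini_integral[OF int] by simp
  also have "\<dots> = prob B" using B by (simp add: integral_poisson[OF r])
  finally show "(\<integral>t. (\<integral>x. indicator B x * poisson r x t \<partial>M) \<partial>circle_lebesgue) = prob B" .
qed

text \<open>Since \<open>P t\<close> is \<open>2 * Re \<mu>\<^sub>+ - 1\<close>, the left side
  equals \<open>P t\<close> divided by the squared modulus of \<open>\<mu>\<^sub>+\<close>, which is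
  at least 1/4.\<close>

lemma inverse_cauchy_transform_le:
  assumes r: "0 \<le> r" "r < 1"
  defines "P \<equiv> \<lambda>t. \<integral>x. poisson r x t \<partial>M"
  shows "1 - (norm (1 / cauchy_transform M (of_real r * fexp 1 t) - 1))\<^sup>2 \<le> min 1 (4 * P t)"
    and "norm (1 / cauchy_transform M (of_real r * fexp 1 t) - 1) \<le> 1"
proof -
  let ?z = "of_real r * fexp 1 t"
  let ?\<mu> = "cauchy_transform M ?z"
  have z: "norm ?z < 1" using r by (simp add: norm_mult)
  have P: "P t = 2 * Re ?\<mu> - 1"
    unfolding P_def poisson_def Re_cauchy_transform(1)[OF z] by (simp add: field_simps)
  have half: "Re ?\<mu> \<ge> 1/2" by (rule Re_cauchy_transform_ge[OF z])
  then have nz: "?\<mu> \<noteq> 0" by auto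
  have ge: "(norm ?\<mu>)\<^sup>2 \<ge> 1/4"
  proof -
    have "1/2 \<le> norm ?\<mu>" using half complex_Re_le_cmod[of ?\<mu>] by linarith
    then have "(1/2)\<^sup>2 \<le> (norm ?\<mu>)\<^sup>2" by (intro power_mono) auto
    then show ?thesis by (simp add: power2_eq_square)
  qed
  have "(norm (1 / ?\<mu> - 1))\<^sup>2 = (norm (1 - ?\<mu>))\<^sup>2 / (norm ?\<mu>)\<^sup>2"
    using nz by (simp add: field_simps flip: norm_divide power_divide)
  also have "(norm (1 - ?\<mu>))\<^sup>2 = (norm ?\<mu>)\<^sup>2 - P t"
    unfolding P cmod_power2 by (simp add: power2_eq_square algebra_simps)
  finally have eq: "1 - (norm (1 / ?\<mu> - 1))\<^sup>2 = P t / (norm ?\<mu>)\<^sup>2"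
    using nz by (simp add: field_simps)
  have "P t / (norm ?\<mu>)\<^sup>2 \<le> P t / (1/4)"
    using ge half P by (intro divide_left_mono) (auto intro: mult_pos_pos less_le_trans[OF _ ge])
  then have "1 - (norm (1 / ?\<mu> - 1))\<^sup>2 \<le> 4 * P t" unfolding eq by simp
  moreover have "1 - (norm (1 / ?\<mu> - 1))\<^sup>2 \<le> 1" by simp
  ultimately show "1 - (norm (1 / ?\<mu> - 1))\<^sup>2 \<le> min 1 (4 * P t)" by simp
  have "P t / (norm ?\<mu>)\<^sup>2 \<ge> 0" using half by (simp add: P)
  then show "norm (1 / ?\<mu> - 1) \<le> 1"
    unfolding eq [symmetric] by (simp add: abs_square_le_1)
qed

section \<open>Square sum of the Taylor coefficients of the reciprocal\<close>

lemma sum_inv_cauchy_coeff_le: "(\<Sum>k<n. (norm (inv_cauchy_coeff M (Suc k)))\<^sup>2) \<le> 1"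
  using sqnorm_residual_fexp_minus_one[of n] sqnorm_L2_nonneg[of M "residual (fexp (- 1)) n"] by simp

lemma summable_inv_cauchy_coeff: "summable (\<lambda>k. (norm (inv_cauchy_coeff M (Suc k)))\<^sup>2)"
  by (rule summableI_nonneg_bounded[OF _ sum_inv_cauchy_coeff_le]) simp

text \<open>Parseval on the circle of radius \<open>r\<close>, where the factors
  \<open>r ^ n\<close> only shrink the coefficients. Measurability is read off from the same
  series.\<close>

lemma sqnorm_inverse_cauchy_transform_le:
  assumes r: "0 \<le> r" "r < 1"
  shows "sqnorm_L2 circle_lebesgue (\<lambda>t. 1 / cauchy_transform M (of_real r * fexp 1 t) - 1) \<le>
    (\<Sum>k. (norm (inv_cauchy_coeff M (Suc k)))\<^sup>2)" (is "_ \<le> ?s")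
    and "(\<lambda>t. 1 / cauchy_transform M (of_real r * fexp 1 t) - 1) \<in> borel_measurable circle_lebesgue"
proof -
  \<comment> \<open>The constant term is 0 because the zeroth coefficient of the reciprocal is 1 and
    cancels against the subtracted 1.\<close>
  define c where "c n = (if n = 0 then 0 else inv_cauchy_coeff M n * of_real r ^ n)" for n
  have \<alpha>: "norm (inv_cauchy_coeff M (Suc k)) \<le> 1" for k
  proof -
    have "(norm (inv_cauchy_coeff M (Suc k)))\<^sup>2 \<le> (\<Sum>k<Suc k. (norm (inv_cauchy_coeff M (Suc k)))\<^sup>2)"
      by (rule member_le_sum) auto
    also have "\<dots> \<le> 1" by (rule sum_inv_cauchy_coeff_le)
    finally show ?thesis by (simp add: abs_square_le_1)
  qed
  have c_le: "norm (c n) \<le> r ^ n" for n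
  proof (cases n)
    case (Suc m)
    have "norm (inv_cauchy_coeff M n) * r ^ n \<le> 1 * r ^ n"
      unfolding Suc using r by (intro mult_right_mono \<alpha> zero_le_power)
    then show ?thesis using r Suc by (simp add: c_def norm_mult norm_power del: power_Suc)
  qed (simp add: c_def)
  have c: "summable (\<lambda>n. norm (c n))"
  proof (rule summable_comparison_test')
    show "summable (\<lambda>n. r ^ n)" using r by (intro summable_geometric) simp
    show "norm (norm (c n)) \<le> r ^ n" if "n \<ge> 0" for n using c_le[of n] by simp
  qed
  have sum: "(\<Sum>n. c n * fexp (of_nat n) t) = 1 / cauchy_transform M (of_real r * fexp 1 t) - 1" for t
  proof -
    let ?z = "of_real r * fexp 1 t"
    have "(\<lambda>n. inv_cauchy_coeff M n * ?z ^ n) sums (1 / cauchy_transform M ?z)"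
      using r by (intro inv_cauchy_coeff_sums) (simp add: norm_mult)
    then have "(\<lambda>n. inv_cauchy_coeff M (Suc n) * ?z ^ Suc n) sums (1 / cauchy_transform M ?z - 1)"
      by (subst sums_Suc_iff) simp
    moreover have "inv_cauchy_coeff M (Suc n) * ?z ^ Suc n = c (Suc n) * fexp (of_nat (Suc n)) t" for n
      using fexp_mult_nat[of "Suc n" 1 t] by (simp add: c_def power_mult_distrib del: of_nat_Suc)
    ultimately have "(\<lambda>n. c (Suc n) * fexp (of_nat (Suc n)) t) sums (1 / cauchy_transform M ?z - 1)"
      by (simp only:)
    then have "(\<lambda>n. c n * fexp (of_nat n) t) sums (1 / cauchy_transform M ?z - 1)"
      by (subst (asm) sums_Suc_iff [where f = "\<lambda>n. c n * fexp (of_nat n) t"]) (simp add: c_def)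
    then show ?thesis by (simp add: sums_iff)
  qed
  have "(\<lambda>n. (norm (c n))\<^sup>2) sums
      sqnorm_L2 circle_lebesgue (\<lambda>t. 1 / cauchy_transform M (of_real r * fexp 1 t) - 1)"
    using Parseval_absolutely_convergent[OF c] unfolding sum .
  then have sums: "(\<lambda>n. (norm (c (Suc n)))\<^sup>2) sums
      sqnorm_L2 circle_lebesgue (\<lambda>t. 1 / cauchy_transform M (of_real r * fexp 1 t) - 1)"
    by (subst sums_Suc_iff) (simp add: c_def)
  have "norm (c (Suc n)) \<le> norm (inv_cauchy_coeff M (Suc n))" for n
    using r mult_left_mono[OF power_le_one[of r "Suc n"] norm_ge_zero[of "inv_cauchy_coeff M (Suc n)"]]
    by (simp add: c_def norm_mult norm_power del: power_Suc)
  then have "(norm (c (Suc n)))\<^sup>2 \<le> (norm (inv_cauchy_coeff M (Suc n)))\<^sup>2" for n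
    by (intro power_mono) auto
  then show "sqnorm_L2 circle_lebesgue (\<lambda>t. 1 / cauchy_transform M (of_real r * fexp 1 t) - 1) \<le> ?s"
    by (rule sums_le[OF _ sums summable_sums[OF summable_inv_cauchy_coeff]])
  have "(\<lambda>t. \<Sum>n. c n * fexp (of_nat n) t) \<in> borel_measurable circle_lebesgue"
    by measurable
  then show "(\<lambda>t. 1 / cauchy_transform M (of_real r * fexp 1 t) - 1) \<in> borel_measurable circle_lebesgue"
    unfolding sum .
qed

text \<open>The function \<open>1 - 1 / \<mu>\<^sub>+\<close> is inner because the Poisson integral of a singular measure
  tends to \<open>0\<close> in Lebesgue measure at the boundary. That its Taylor coefficients have
  \<open>\<ell>\<^sup>2\<close>-norm \<open>1\<close> is the only consequence of singularity that the proof uses.\<close>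

lemma suminf_inv_cauchy_coeff:
  assumes sing: "mutually_singular M circle_lebesgue"
  shows "(\<Sum>k. (norm (inv_cauchy_coeff M (Suc k)))\<^sup>2) = 1" (is "?s = 1")
proof (rule antisym)
  show "?s \<le> 1"
    by (rule suminf_le_const[OF summable_inv_cauchy_coeff sum_inv_cauchy_coeff_le])
  show "1 \<le> ?s"
  proof (rule field_le_epsilon)
    fix e :: real assume e: "e > 0"
    \<comment> \<open>\<open>e / 4\<close> compensates the factor 4 in front of the Poisson
      integral.\<close>
    obtain K where K: "compact K" "K \<subseteq> circle" "K \<in> sets M" "emeasure circle_lebesgue K = 0"
        "prob (circle - K) < e / 4"
      using singular_compact_support[OF sing, of "e / 4"] e by auto
    define r where "r n = 1 - 1 / real (Suc n)" for n
    have r: "0 \<le> r n" "r n < 1" for n by (auto simp: r_def)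
    have "r \<longlonglongrightarrow> 1 - 0" unfolding r_def by (intro tendsto_intros LIMSEQ_Suc[OF lim_1_over_n])
    then have r1: "r \<longlonglongrightarrow> 1" by simp
    define P where "P B n t = (\<integral>x. indicator B x * poisson (r n) x t \<partial>M)" for B n t
    have compl: "circle - K \<in> sets M" using K(3) sets.compl_sets[of K M] by (simp add: space_M)
    have P_int: "integrable circle_lebesgue (P B n)" if "B \<in> sets M" for B n
      unfolding P_def by (rule integral_poisson_integral(2)[OF r that])
    have P_nonneg: "P B n t \<ge> 0" for B n t
      unfolding P_def by (intro Bochner_Integration.integral_nonneg) (simp add: poisson_nonneg[OF r])
    have kernel_int: "integrable M (\<lambda>x. indicator B x * poisson (r n) x t)" if B: "B \<in> sets M" for B n t
    proof (rule integrable_bounded_circle[where B = "1 / (1 - r n)\<^sup>2"])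
      note [measurable] = B
      show "(\<lambda>x. indicator B x * poisson (r n) x t) \<in> borel_measurable M" by measurable
      show "norm (indicator B x * poisson (r n) x t) \<le> 1 / (1 - r n)\<^sup>2" for x
        using poisson_bound[OF r, of n x t] r[of n] by (simp add: indicator_def)
    qed
    have split: "(\<integral>x. poisson (r n) x t \<partial>M) = P K n t + P (circle - K) n t" for n t
      unfolding P_def Bochner_Integration.integral_add[OF kernel_int[OF K(3)] kernel_int[OF compl], symmetric]
      by (intro Bochner_Integration.integral_cong refl) (auto simp: space_M indicator_def)
    let ?f = "\<lambda>n t. 1 / cauchy_transform M (of_real (r n) * fexp 1 t) - 1"
    have bound: "1 - ?s \<le> (\<integral>t. min 1 (4 * P K n t) \<partial>circle_lebesgue) + e" for n
    proof -
      \<comment> \<open>Only the part over \<open>K\<close> stays truncated: it tends to 0 pointwise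
        and needs a majorant. The part off \<open>K\<close> is controlled through its mean.\<close>
      have pt: "1 - (norm (?f n t))\<^sup>2 \<le> min 1 (4 * P K n t) + 4 * P (circle - K) n t" for t
      proof -
        have "1 - (norm (?f n t))\<^sup>2 \<le> min 1 (4 * (P K n t + P (circle - K) n t))"
          using inverse_cauchy_transform_le(1)[OF r, of n t] unfolding split .
        also have "\<dots> \<le> min 1 (4 * P K n t) + 4 * P (circle - K) n t"
          using P_nonneg[of "circle - K" n t] by (simp add: min_def)
        finally show ?thesis .
      qed
      have min_int: "integrable circle_lebesgue (\<lambda>t. min 1 (4 * P K n t))"
        using P_nonneg P_int[OF K(3), of n]
        by (intro L.integrable_bounded_circle[where B = 1]) (auto dest: borel_measurable_integrable)
      have f_int: "integrable circle_lebesgue (\<lambda>t. (norm (?f n t))\<^sup>2)"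
      proof (rule Bochner_Integration.integrable_bound)
        show "integrable circle_lebesgue (\<lambda>t. 1::real)" by (rule L.integrable_const)
        note [measurable] = sqnorm_inverse_cauchy_transform_le(2)[OF r, of n]
        show "(\<lambda>t. (norm (?f n t))\<^sup>2) \<in> borel_measurable circle_lebesgue" by measurable
        show "AE t in circle_lebesgue. norm ((norm (?f n t))\<^sup>2) \<le> norm (1::real)"
          using inverse_cauchy_transform_le(2)[OF r, of n] by (simp add: abs_square_le_1)
      qed
      have "1 - ?s \<le> 1 - sqnorm_L2 circle_lebesgue (?f n)"
        using sqnorm_inverse_cauchy_transform_le(1)[OF r, of n] by simp
      also have "\<dots> = (\<integral>t. 1 - (norm (?f n t))\<^sup>2 \<partial>circle_lebesgue)"
        using f_int by (simp add: sqnorm_L2_def L.prob_space)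
      also have "\<dots> \<le> (\<integral>t. min 1 (4 * P K n t) + 4 * P (circle - K) n t \<partial>circle_lebesgue)"
        using f_int min_int P_int[OF compl, of n] pt by (intro integral_mono) auto
      also have "\<dots> = (\<integral>t. min 1 (4 * P K n t) \<partial>circle_lebesgue) + 4 * prob (circle - K)"
        using min_int P_int[OF compl, of n] integral_poisson_integral(1)[OF r compl, of n, folded P_def] by simp
      finally show ?thesis using K(5) by simp
    qed
    \<comment> \<open>Since \<open>K\<close> is Lebesgue-null, almost every \<open>t\<close> lies
      off \<open>K\<close>, where the integrand tends to 0; the truncation supplies the majorant
      1.\<close>
    have "(\<lambda>n. \<integral>t. min 1 (4 * P K n t) \<partial>circle_lebesgue) \<longlonglongrightarrow> (\<integral>t. 0 \<partial>circle_lebesgue)"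
    proof (rule integral_dominated_convergence)
      show "integrable circle_lebesgue (\<lambda>t. 1::real)" by (rule L.integrable_const)
      show "(\<lambda>t. min 1 (4 * P K n t)) \<in> borel_measurable circle_lebesgue" for n
        using P_int[OF K(3), of n] by (auto dest: borel_measurable_integrable)
      show "AE t in circle_lebesgue. norm (min 1 (4 * P K n t)) \<le> 1" for n
        using P_nonneg by auto
      have "AE t in circle_lebesgue. t \<notin> K"
        using K(3,4) L.sets_M sets_M by (intro AE_not_in) (auto simp: null_sets_def)
      moreover have "AE t in circle_lebesgue. t \<in> circle"
        using L.space_M by (intro AE_I2) simp
      ultimately show "AE t in circle_lebesgue. (\<lambda>n. min 1 (4 * P K n t)) \<longlonglongrightarrow> 0"
      proof eventually_elim
        case (elim t)
        then have "(\<lambda>n. P K n t) \<longlonglongrightarrow> 0"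
          unfolding P_def by (intro poisson_integral_tendsto_0 K r r1) auto
        then have "(\<lambda>n. min 1 (4 * P K n t)) \<longlonglongrightarrow> min 1 (4 * 0)"
          by (intro tendsto_intros)
        then show ?case by simp
      qed
    qed simp
    then have "(\<lambda>n. (\<integral>t. min 1 (4 * P K n t) \<partial>circle_lebesgue) + e) \<longlonglongrightarrow> 0 + e"
      by (intro tendsto_intros) simp
    then have "1 - ?s \<le> 0 + e"
      by (rule LIMSEQ_le_const) (use bound in auto)
    then show "1 \<le> ?s + e" by simp
  qed
qed

lemma kaczmarz_converges_fexp_minus_one:
  assumes "mutually_singular M circle_lebesgue"
  shows "kaczmarz_converges (fexp (- 1))"
proof -
  have "(\<lambda>n. 1 - (\<Sum>k<n. (norm (inv_cauchy_coeff M (Suc k)))\<^sup>2)) \<longlonglongrightarrow>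
      1 - (\<Sum>k. (norm (inv_cauchy_coeff M (Suc k)))\<^sup>2)"
    by (intro tendsto_intros summable_LIMSEQ summable_inv_cauchy_coeff)
  then show ?thesis
    unfolding kaczmarz_converges_def sqnorm_residual_fexp_minus_one suminf_inv_cauchy_coeff[OF assms] by simp
qed

end

section \<open>Complex exponentials\<close>

inductive trig_poly :: "(real \<Rightarrow> complex) \<Rightarrow> bool" where
  trig_poly_fexp: "trig_poly (\<lambda>x. c * fexp (of_int k) x)"
| trig_poly_add: "trig_poly p \<Longrightarrow> trig_poly q \<Longrightarrow> trig_poly (\<lambda>x. p x + q x)"

lemma trig_poly_const: "trig_poly (\<lambda>x. c)"
  using trig_poly_fexp[of c 0] by simp

lemma trig_poly_mult:
  assumes "trig_poly p" "trig_poly q"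
  shows "trig_poly (\<lambda>x. p x * q x)"
  using assms(1)
proof induction
  case (trig_poly_fexp c k)
  from assms(2) show ?case
  proof induction
    case (trig_poly_fexp d l)
    have "(\<lambda>x. c * fexp (of_int k) x * (d * fexp (of_int l) x)) = (\<lambda>x. (c * d) * fexp (of_int (k + l)) x)"
      by (simp add: fexp_add mult_ac)
    then show ?case by (simp only: trig_poly.trig_poly_fexp)
  qed (simp add: distrib_left trig_poly_add)
qed (simp add: distrib_right trig_poly_add)

text \<open>On the unit circle \<open>cnj u\<close> has frequency -1, so the real coordinates of
  \<open>u\<close> are combinations of \<open>fexp 1\<close> and \<open>fexp (- 1)\<close>; products
  are covered by \<open>trig_poly_mult\<close>.\<close>

lemma trig_poly_real_polynomial_function:
  assumes "real_polynomial_function g"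
  shows "trig_poly (\<lambda>x. of_real (g (fexp 1 x)))"
  using assms
proof induction
  case (linear f)
  interpret bounded_linear f by fact
  have f: "f z = Re z * f 1 + Im z * f \<i>" for z
  proof -
    have "f z = f (Re z *\<^sub>R 1 + Im z *\<^sub>R \<i>)"
      by (rule arg_cong[where f = f]) (simp add: complex_eq_iff)
    then show ?thesis by (simp only: add scaleR) simp
  qed
  let ?a = "complex_of_real (f 1)" and ?b = "complex_of_real (f \<i>)"
  have Re: "of_real (Re u) = (u + cnj u) / 2" and Im: "of_real (Im u) = (u - cnj u) / (2 * \<i>)" for u
    by (simp_all add: complex_eq_iff)
  have "(\<lambda>x. complex_of_real (f (fexp 1 x))) =
      (\<lambda>x. (?a / 2 + ?b / (2 * \<i>)) * fexp (of_int 1) x + (?a / 2 - ?b / (2 * \<i>)) * fexp (of_int (- 1)) x)"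
    by (subst f) (simp add: Re Im cnj_fexp algebra_simps add_divide_distrib diff_divide_distrib)
  then show ?case
    by (simp only: trig_poly.intros)
qed (simp_all add: trig_poly_const trig_poly_add trig_poly_mult)

lemma trig_poly_polynomial_function:
  assumes "polynomial_function g"
  shows "trig_poly (\<lambda>x. g (fexp 1 x))"
proof -
  have "real_polynomial_function (Re \<circ> g)" "real_polynomial_function (Im \<circ> g)"
    using assms bounded_linear_Re bounded_linear_Im unfolding polynomial_function_def by blast+
  then have "trig_poly (\<lambda>x. of_real ((Re \<circ> g) (fexp 1 x)) + \<i> * of_real ((Im \<circ> g) (fexp 1 x)))"
    by (intro trig_poly_add trig_poly_mult trig_poly_const trig_poly_real_polynomial_function)
  then show ?thesis by (simp add: complex_eq [symmetric])
qed

text \<open>Half-angle formula: \<open>1 + fexp 1 x\<close> is \<open>2 * cos (pi * x)\<close> times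
  the exponential of \<open>\<i> * pi * x\<close>, and the cosine is positive on the open
  interval.\<close>

lemma Im_Ln_one_plus_fexp:
  assumes "x \<in> circle"
  shows "Re (1 + fexp 1 x) > 0" "Im (Ln (1 + fexp 1 x)) = pi * x"
proof -
  have x: "- (pi / 2) < pi * x" "pi * x < pi / 2"
    using assms mult_strict_left_mono[of x "1/2" pi] mult_strict_left_mono[of "-1/2" x pi] by (auto simp: circle_def)
  then have cos: "cos (pi * x) > 0" by (intro cos_gt_zero_pi) auto
  have "1 + fexp 1 x = cis (pi * x) * (cis (- (pi * x)) + cis (pi * x))"
    by (simp add: fexp_def distrib_left cis_mult cis_conv_exp exp_add [symmetric] algebra_simps)
  also have "cis (- (pi * x)) + cis (pi * x) = of_real (2 * cos (pi * x))"
    by (simp add: complex_eq_iff)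
  finally have eq: "1 + fexp 1 x = of_real (2 * cos (pi * x)) * exp (\<i> * of_real (pi * x))"
    by (simp add: cis_conv_exp mult.commute)
  have "Ln (exp (\<i> * of_real (pi * x))) = \<i> * of_real (pi * x)"
    using x by (intro Ln_exp) (auto intro: less_trans[OF _ x(1)])
  then show "Im (Ln (1 + fexp 1 x)) = pi * x"
    unfolding eq using cos by (subst Ln_times_of_real) (auto simp: Ln_of_real simp del: of_real_mult)
  show "Re (1 + fexp 1 x) > 0"
    unfolding eq cis_conv_exp [symmetric] using cos by simp
qed

section \<open>Convergence for continuous functions and for complex frequencies\<close>

context circle_measure
begin

lemma sqnorm_L2_le_const:
  assumes "square_integrable M f" "\<And>x. x \<in> circle \<Longrightarrow> (norm (f x))\<^sup>2 \<le> c"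
  shows "sqnorm_L2 M f \<le> c"
  unfolding sqnorm_L2_def using assms by (intro integral_le_const AE_I2) (auto simp: square_integrable_def space_M)

lemma kaczmarz_converges_trig_poly:
  assumes m1: "kaczmarz_converges (fexp (- 1))" and p: "trig_poly p"
  shows "kaczmarz_converges p" "square_integrable M p"
proof -
  have "kaczmarz_converges p \<and> square_integrable M p"
    using p by induction (auto intro: kaczmarz_converges_cmult kaczmarz_converges_fexp_int[OF m1] kaczmarz_converges_add)
  then show "kaczmarz_converges p" "square_integrable M p" by auto
qed

text \<open>Stone-Weierstrass gives polynomials uniformly within \<open>sqrt e\<close> on the
  circle, hence trigonometric polynomials within \<open>e\<close> in squared norm.\<close>

lemma kaczmarz_converges_continuous:
  assumes m1: "kaczmarz_converges (fexp (- 1))" and g: "continuous_on (sphere 0 1) g"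
  shows "square_integrable M (\<lambda>x. g (fexp 1 x))" "kaczmarz_converges (\<lambda>x. g (fexp 1 x))"
proof -
  have "continuous_on UNIV (\<lambda>x. g (fexp 1 x))"
    by (rule continuous_on_compose2[OF g]) (auto intro!: continuous_intros)
  then have "(\<lambda>x. g (fexp 1 x)) \<in> borel_measurable M"
    by (intro measurable_borel_imp_M borel_measurable_continuous_onI)
  moreover obtain B where "\<And>z. z \<in> sphere 0 1 \<Longrightarrow> norm (g z) \<le> B"
    using compact_imp_bounded[OF compact_continuous_image[OF g compact_sphere]] by (force simp: bounded_iff)
  ultimately show si: "square_integrable M (\<lambda>x. g (fexp 1 x))"
    by (intro square_integrable_bounded[where B = B]) auto
  show "kaczmarz_converges (\<lambda>x. g (fexp 1 x))"
  proof (rule kaczmarz_converges_approx[OF si])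
    fix e :: real assume e: "e > 0"
    obtain p where p: "polynomial_function p" "\<And>z. z \<in> sphere 0 1 \<Longrightarrow> norm (g z - p z) < sqrt e"
      using Stone_Weierstrass_polynomial_function[OF compact_sphere g, of "sqrt e"] e by auto
    note tp = kaczmarz_converges_trig_poly[OF m1 trig_poly_polynomial_function[OF p(1)]]
    have "(norm (g (fexp 1 x) - p (fexp 1 x)))\<^sup>2 \<le> e" for x
      using power_mono[OF less_imp_le[OF p(2)[of "fexp 1 x"]], of 2] e by simp
    then have "sqnorm_L2 M (\<lambda>x. g (fexp 1 x) - p (fexp 1 x)) \<le> e"
      by (intro sqnorm_L2_le_const square_integrable_diff si tp(2))
    then show "\<exists>p. square_integrable M p \<and> kaczmarz_converges p \<and> sqnorm_L2 M (\<lambda>x. g (fexp 1 x) - p x) \<le> e"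
      using tp by blast
  qed
qed

text \<open>For non-integral \<open>w\<close> the function \<open>fexp w\<close> jumps at the removed point of the circle. On the
  interval it is the bounded limit, as \<open>r \<rightarrow> 1\<close>, of continuous functions of \<open>u = e\<^bsup>2\<pi>ix\<^esup>\<close>,
  since \<open>arg (1 + u) = \<pi>x\<close>.\<close>

lemma kaczmarz_converges_fexp:
  assumes m1: "kaczmarz_converges (fexp (- 1))"
  shows "kaczmarz_converges (fexp w)"
proof (rule kaczmarz_converges_approx)
  show "square_integrable M (fexp w)" by simp
  \<comment> \<open>For \<open>0 \<le> r < 1\<close> the point \<open>1 + r z\<close> stays in the
    right half plane, so its argument is continuous on the whole circle. At \<open>r = 1\<close> and
    \<open>z = fexp 1 x\<close> twice the argument is \<open>2 * pi * x\<close>, so \<open>G\<close>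
    becomes \<open>fexp w x\<close>.\<close>
  define G where "G r z = exp (w * (2 * \<i> * of_real (Im (Ln (1 + of_real r * z)))))" for r :: real and z :: complex
  have cont: "continuous_on (sphere 0 1) (G r)" if r: "0 \<le> r" "r < 1" for r
  proof -
    have "1 + of_real r * z \<notin> \<real>\<^sub>\<le>\<^sub>0" if "z \<in> sphere 0 1" for z :: complex
    proof -
      have "norm (of_real r * z) < 1" using r that by (simp add: norm_mult)
      then have "Re (1 + of_real r * z) > 0"
        using abs_Re_le_cmod[of "of_real r * z"] by (simp only: plus_complex.simps one_complex.simps)
      then show ?thesis by (auto simp: complex_nonpos_Reals_iff)
    qed
    then show ?thesis unfolding G_def by (intro continuous_intros) auto
  qed
  have bound: "norm (G r z) \<le> exp (2 * pi * norm w)" if "1 + of_real r * z \<noteq> 0" for r z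
  proof -
    \<comment> \<open>Arguments are at most \<pi> in modulus, a bound independent of
      \<open>r\<close> that serves for dominated convergence.\<close>
    have "norm (w * (2 * \<i> * of_real (Im (Ln (1 + of_real r * z))))) \<le> 2 * pi * norm w"
    proof -
      have "\<bar>Im (Ln (1 + of_real r * z))\<bar> \<le> pi"
        using mpi_less_Im_Ln[OF that] Im_Ln_le_pi[OF that] by linarith
      from mult_left_mono[OF this norm_ge_zero[of w]] show ?thesis
        by (simp add: norm_mult mult.commute)
    qed
    then show ?thesis unfolding G_def by (intro order_trans[OF norm_exp]) simp
  qed
  define r where "r n = 1 - 1 / real (Suc n)" for n
  have r: "0 \<le> r n" "r n < 1" for n by (auto simp: r_def)
  have "r \<longlonglongrightarrow> 1 - 0" unfolding r_def by (intro tendsto_intros LIMSEQ_Suc[OF lim_1_over_n])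
  then have r1: "r \<longlonglongrightarrow> 1" by simp
  note G = kaczmarz_converges_continuous[OF m1 cont[OF r]]
  have "(\<lambda>n. \<integral>x. (norm (fexp w x - G (r n) (fexp 1 x)))\<^sup>2 \<partial>M) \<longlonglongrightarrow> (\<integral>x. 0 \<partial>M)"
  proof (rule integral_dominated_convergence)
    let ?B = "(exp (pi * norm w) + exp (2 * pi * norm w))\<^sup>2"
    show "integrable M (\<lambda>x. ?B)" by (rule integrable_const)
    note [measurable] = square_integrable_measurable[OF G(1)]
    show "(\<lambda>x. (norm (fexp w x - G (r n) (fexp 1 x)))\<^sup>2) \<in> borel_measurable M" for n
      by measurable
    show "AE x in M. norm ((norm (fexp w x - G (r n) (fexp 1 x)))\<^sup>2) \<le> ?B" for n
    proof (rule AE_I2)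
      fix x assume "x \<in> space M"
      then have x: "x \<in> circle" by (simp add: space_M)
      have "norm (of_real (r n) * fexp 1 x) < 1" using r by (simp add: norm_mult)
      then have "1 + of_real (r n) * fexp 1 x \<noteq> 0"
        by (metis add_eq_0_iff norm_minus_cancel norm_one less_irrefl)
      then have "norm (fexp w x - G (r n) (fexp 1 x)) \<le> exp (pi * norm w) + exp (2 * pi * norm w)"
        by (intro order_trans[OF norm_triangle_ineq4] add_mono norm_fexp_le_circle x bound)
      then show "norm ((norm (fexp w x - G (r n) (fexp 1 x)))\<^sup>2) \<le> ?B" by (simp add: power_mono)
    qed
    show "AE x in M. (\<lambda>n. (norm (fexp w x - G (r n) (fexp 1 x)))\<^sup>2) \<longlonglongrightarrow> 0"
    proof (rule AE_I2)
      fix x assume "x \<in> space M"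
      then have x: "x \<in> circle" by (simp add: space_M)
      have "1 + of_real 1 * fexp 1 x \<notin> \<real>\<^sub>\<le>\<^sub>0"
        using Im_Ln_one_plus_fexp(1)[OF x] by (auto simp: complex_nonpos_Reals_iff)
      then have "(\<lambda>n. G (r n) (fexp 1 x)) \<longlonglongrightarrow> G 1 (fexp 1 x)"
        unfolding G_def by (intro tendsto_intros r1)
      also have "G 1 (fexp 1 x) = fexp w x"
        using Im_Ln_one_plus_fexp(2)[OF x] by (simp add: G_def fexp_def algebra_simps)
      finally have "(\<lambda>n. (norm (fexp w x - G (r n) (fexp 1 x)))\<^sup>2) \<longlonglongrightarrow> (norm (fexp w x - fexp w x))\<^sup>2"
        by (intro tendsto_intros)
      then show "(\<lambda>n. (norm (fexp w x - G (r n) (fexp 1 x)))\<^sup>2) \<longlonglongrightarrow> 0" by simp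
    qed
  qed simp
  then have lim: "(\<lambda>n. sqnorm_L2 M (\<lambda>x. fexp w x - G (r n) (fexp 1 x))) \<longlonglongrightarrow> 0"
    by (simp add: sqnorm_L2_def)
  fix e :: real assume e: "e > 0"
  then obtain n where "sqnorm_L2 M (\<lambda>x. fexp w x - G (r n) (fexp 1 x)) < e"
    using order_tendstoD(2)[OF lim e] eventually_sequentially by auto
  then show "\<exists>p. square_integrable M p \<and> kaczmarz_converges p \<and> sqnorm_L2 M (\<lambda>x. fexp w x - p x) \<le> e"
    using G[of n] less_imp_le by blast
qed

section \<open>The integrals of the theorem as inner products\<close>

lemma inner_fexp_cnj:
  "inner_L2 M f (fexp (cnj z)) = (\<integral>x. f x * exp (- 2 * of_real pi * \<i> * of_real x * z) \<partial>M)"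
  by (simp add: inner_L2_def cnj_fexp) (simp add: fexp_def mult.commute mult.left_commute)

lemma inner_dual_vector_fexp:
  "inner_L2 M (dual_vector n) (fexp (cnj z)) =
    (\<Sum>k\<le>n. cnj (inv_cauchy_coeff M (n - k)) * fourier_stieltjes M (z - of_nat k))"
  unfolding dual_vector_def
  by (subst inner_L2_sum_left) (auto simp: inner_L2_cmult_left inner_fexp)

end

theorem theorem1:
  fixes M :: "real measure" and F :: "complex \<Rightarrow> complex" and \<alpha> :: "nat \<Rightarrow> complex"
  assumes "prob_space M"
    and "sets M = sets (restrict_space borel circle)"
    and "mutually_singular M (restrict_space lborel circle)"
    and "F holomorphic_on UNIV"
  defines "\<alpha> \<equiv> inv_cauchy_coeff M"
  shows "(\<exists>f. square_integrable M f \<and>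
            (\<forall>z. F z = (\<integral>x. f x * exp (- 2 * of_real pi * \<i> * of_real x * z) \<partial>M)))
     \<longleftrightarrow>
         summable (\<lambda>n. (norm (\<Sum>j\<le>n. \<alpha> (n - j) * F (of_nat j)))\<^sup>2) \<and>
         (\<forall>z. (\<lambda>n. (\<Sum>j\<le>n. \<alpha> (n - j) * F (of_nat j)) *
                   (\<Sum>k\<le>n. cnj (\<alpha> (n - k)) * fourier_stieltjes M (z - of_nat k))) sums F z)"
proof -
  interpret circle_measure M
    by (intro circle_measure.intro circle_measure_axioms.intro) (fact assms)+
  \<comment> \<open>Singularity enters here: the iteration recovers every complex exponential in the
    limit.\<close>
  note conv = kaczmarz_converges_fexp[OF kaczmarz_converges_fexp_minus_one[OF assms(3)]]
  define c where "c n = (\<Sum>j\<le>n. \<alpha> (n - j) * F (of_nat j))" for n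
  have ip: "inner_L2 M (dual_vector n) (fexp (cnj z)) =
      (\<Sum>k\<le>n. cnj (\<alpha> (n - k)) * fourier_stieltjes M (z - of_nat k))" for n z
    by (simp add: inner_dual_vector_fexp \<alpha>_def)
  show ?thesis
    unfolding c_def [symmetric] ip [symmetric] inner_fexp_cnj [symmetric]
  proof safe
    fix f assume f: "square_integrable M f" and F: "\<forall>z. F z = inner_L2 M f (fexp (cnj z))"
    \<comment> \<open>At \<open>z = of_nat j\<close> the frequency \<open>cnj z\<close> is
      \<open>j\<close> itself, so the values \<open>F (of_nat j)\<close> are the inner products that
      determine the coefficients.\<close>
    have c: "c n = kaczmarz_coeff f n" for n
      using F by (simp add: c_def kaczmarz_coeff_eq[OF f] \<alpha>_def)
    show "summable (\<lambda>n. (norm (c n))\<^sup>2)"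
      unfolding c by (rule summableI_nonneg_bounded[OF _ Bessel_kaczmarz[OF f]]) auto
    show "(\<lambda>n. c n * inner_L2 M (dual_vector n) (fexp (cnj z))) sums F z" for z
      using kaczmarz_expansion[OF f square_integrable_fexp conv, of "cnj z"] F
      by (simp add: c kaczmarz_coeff_def inner_L2_cnj)
  next
    assume c: "summable (\<lambda>n. (norm (c n))\<^sup>2)"
      and F: "\<forall>z. (\<lambda>n. c n * inner_L2 M (dual_vector n) (fexp (cnj z))) sums F z"
    obtain f where f: "square_integrable M f"
      "\<And>h. square_integrable M h \<Longrightarrow> (\<lambda>n. c n * inner_L2 M (dual_vector n) h) sums inner_L2 M f h"
      using dual_synthesis[OF c] by blast
    \<comment> \<open>By (ii) and by the choice of \<open>f\<close>, both sides are sums of the same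
      series.\<close>
    have "F z = inner_L2 M f (fexp (cnj z))" for z
      using F f(2)[OF square_integrable_fexp] sums_unique2 by blast
    with f(1) show "\<exists>f. square_integrable M f \<and> (\<forall>z. F z = inner_L2 M f (fexp (cnj z)))" by blast
  qed
qed

end
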